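(* Let $\Gamma$ be a countable group with a proper left-invariant distance, and let $\mu$ be a symmetric probability measure on $\Gamma$ with finite entropy. Then $$2\sqrt{1-\rho^2}\,\operatorname{artanh}\sqrt{1-\rho^2}\le h .$$ Moreover, if $\mu$ has a finite second moment and $\mu\ne\delta_e$, then, with $\tilde\ell=\ell/M_2(\mu)$, $$2\,\tilde\ell\,\operatorname{artanh}\tilde\ell\le h .$$
   Context: A distance $\operatorname{dist}$ on $\Gamma$ is proper if all balls are finite, and left-invariant if $\operatorname{dist}(\gamma g,\gamma g')=\operatorname{dist}(g,g')$ for all $\gamma,g,g'\in\Gamma$. Write $e$ for the identity and $|g|=\operatorname{dist}(g,e)$. A probability measure $\mu$ on $\Gamma$ is symmetric if $\mu(g)=\mu(g^{-1})$ for all $g$. It has finite entropy if $H(\mu)=-\sum_g\mu(g)\log\mu(g)<\infty$, and finite second moment if $M_2(\mu):=\left(\sum_g|g|^2\mu(g)\right)^{1/2}<\infty$. Let $\mu^{*n}$ be the $n$-fold convolution of $\mu$. The asymptotic entropy, spectral radius and drift are $$h=\lim_n-\frac1n\sum_g\mu^{*n}(g)\log\mu^{*n}(g),\qquad \rho=\limsup_n\sqrt[n]{\mu^{*n}(e)},\qquad \ell=\lim_n\frac1n\sum_g|g|\,\mu^{*n}(g)$$ ($\ell$ is well defined when $\mu$ has finite first moment). Here $\operatorname{artanh}(x)=\frac12\log\frac{1+x}{1-x}$ on $[0,1)$, and $\operatorname{artanh}(1)=+\infty$. *)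

theory Defs
  imports "HOL-Probability.Probability"
begin

text \<open>
  The group is a type of class \<open>group_add\<close>, which is not assumed commutative: the product
  is written \<open>g + h\<close>, the identity \<open>0\<close> and the inverse \<open>- g\<close>.  A probability measure on the
  (countable, discrete) group is a \<open>pmf\<close>.
\<close>

definition proper_dist :: "('a \<Rightarrow> 'a \<Rightarrow> real) \<Rightarrow> bool" where
  "proper_dist d \<longleftrightarrow> (\<forall>x r. finite (Metric_space.mcball UNIV d x r))"

definition left_invariant_dist :: "('a::group_add \<Rightarrow> 'a \<Rightarrow> real) \<Rightarrow> bool" where
  "left_invariant_dist d \<longleftrightarrow> (\<forall>\<gamma> g g'. d (\<gamma> + g) (\<gamma> + g') = d g g')"

definition symmetric_pmf :: "'a::group_add pmf \<Rightarrow> bool" where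
  "symmetric_pmf \<mu> \<longleftrightarrow> (\<forall>g. pmf \<mu> g = pmf \<mu> (- g))"

definition convolution_pmf :: "'a::group_add pmf \<Rightarrow> 'a pmf \<Rightarrow> 'a pmf" where
  "convolution_pmf \<mu> \<nu> = map_pmf (\<lambda>(x, y). x + y) (pair_pmf \<mu> \<nu>)"

primrec conv_power :: "'a::group_add pmf \<Rightarrow> nat \<Rightarrow> 'a pmf" where
  "conv_power \<mu> 0 = return_pmf 0"
| "conv_power \<mu> (Suc n) = convolution_pmf (conv_power \<mu> n) \<mu>"

text \<open>
  The terms of the entropy series are nonnegative, so unconditional summability means that the
  entropy is finite; the convention \<open>0 log 0 = 0\<close> holds automatically.  Infinite sums
  and limits below take unspecified or default values when they do not exist.
\<close>

definition finite_entropy_pmf :: "'a pmf \<Rightarrow> bool" where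
  "finite_entropy_pmf \<mu> \<longleftrightarrow> (\<lambda>g. - (pmf \<mu> g * ln (pmf \<mu> g))) summable_on UNIV"

definition entropy_pmf :: "'a pmf \<Rightarrow> real" where
  "entropy_pmf \<mu> = (\<Sum>\<^sub>\<infinity>g. - (pmf \<mu> g * ln (pmf \<mu> g)))"

definition asymptotic_entropy :: "'a::group_add pmf \<Rightarrow> real" where
  "asymptotic_entropy \<mu> = lim (\<lambda>n. entropy_pmf (conv_power \<mu> n) / real n)"

text \<open>The upper limit is taken in \<open>ereal\<close>; it lies in \<open>[0, 1]\<close>, so nothing is lost in
  passing back to \<open>real\<close>.\<close>

definition spectral_radius_pmf :: "'a::group_add pmf \<Rightarrow> real" where
  "spectral_radius_pmf \<mu> = real_of_ereal (limsup (\<lambda>n. ereal (root n (pmf (conv_power \<mu> n) 0))))"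

definition finite_second_moment :: "('a::group_add \<Rightarrow> 'a \<Rightarrow> real) \<Rightarrow> 'a pmf \<Rightarrow> bool" where
  "finite_second_moment d \<mu> \<longleftrightarrow> (\<lambda>g. (d g 0)\<^sup>2 * pmf \<mu> g) summable_on UNIV"

definition M2 :: "('a::group_add \<Rightarrow> 'a \<Rightarrow> real) \<Rightarrow> 'a pmf \<Rightarrow> real" where
  "M2 d \<mu> = sqrt (\<Sum>\<^sub>\<infinity>g. (d g 0)\<^sup>2 * pmf \<mu> g)"

definition drift :: "('a::group_add \<Rightarrow> 'a \<Rightarrow> real) \<Rightarrow> 'a pmf \<Rightarrow> real" where
  "drift d \<mu> = lim (\<lambda>n. (\<Sum>\<^sub>\<infinity>g. d g 0 * pmf (conv_power \<mu> n) g) / real n)"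

text \<open>The library function satisfies \<open>artanh 1 = 0\<close> because division by zero yields zero, hence
  the explicit value \<open>\<infinity>\<close> at \<open>1\<close>.  Only arguments in \<open>[0, 1]\<close> are of interest.\<close>

definition artanh_ext :: "real \<Rightarrow> ereal" where
  "artanh_ext x = (if x < 1 then ereal (artanh x) else \<infinity>)"

end

theory Submission
  imports Defs "HOL-Real_Asymp.Real_Asymp"
begin

text \<open>
  Entropy production is a Dirichlet form.  For a density \<open>p\<close> on the group, one step of the symmetric walk
  changes the expectation of \<open>- ln p\<close> by
  \<open>(1/2) \<Sum>\<^sub>x\<^sub>,\<^sub>y \<mu>(-x+y) (p x - p y) (ln (p x) - ln (p y))\<close>.  Writing
  \<open>t = (ln (p x) - ln (p y)) / 2\<close>, the product of differences is \<open>2 t tanh t\<close> times \<open>p x + p y\<close>, and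
  \<open>\<mu>(-x+y) (p x + p y) / 2\<close> is a probability distribution on pairs.  Both inequalities of the theorem
  are convexity bounds for the average of \<open>2 t tanh t\<close>, which is \<open>2 r artanh r\<close> for \<open>r = tanh t\<close>.

  For the spectral radius, \<open>2 t tanh t\<close> is convex and decreasing in \<open>1 / cosh t\<close>, which is
  \<open>2 \<surd>(p x p y) / (p x + p y)\<close>.  The average of this quantity is the quadratic form of the walk at
  \<open>\<surd>p\<close>, a unit vector, hence at most \<open>\<rho>\<close> (\<open>has_sum_geometric_mean_le_spectral_radius\<close>).  For the
  drift, \<open>2 t tanh t\<close> is convex and increasing in \<open>tanh\<^sup>2 t\<close>, where \<open>tanh t = (p x - p y) / (p x + p y)\<close>.
  One step changes the mean length by at most
  \<open>(1/2) \<Sum>\<^sub>x\<^sub>,\<^sub>y \<mu>(-x+y) |-x+y| |p x - p y|\<close>, and by the Cauchy--Schwarz inequality this is at most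
  \<open>M\<^sub>2\<close> times the root of the average of \<open>tanh\<^sup>2 t\<close>.  In both cases the convexity is used through
  tangent lines (\<open>log_difference_ge_geometric_mean\<close>, \<open>log_difference_ge_weighted_difference\<close>), so that
  only linear expressions are summed.

  It remains to find densities \<open>p\<close> whose entropy production is at most about \<open>h\<close> while the mean length
  grows at least at the rate \<open>l\<close>.  Take the law \<open>p\<close> of the walk at an independent geometric time of
  parameter \<open>1 - z\<close>.  It satisfies \<open>p - p * \<mu> = (1 - z) / z (\<delta>\<^sub>0 - p)\<close>, and therefore its entropy
  production is at most \<open>(1 - z) / z H(p)\<close>.  The geometric time has mean \<open>z / (1 - z)\<close> and
  comparatively small entropy, so this upper bound is at most \<open>h + o(1)\<close> as \<open>z\<close> tends to \<open>1\<close>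
  (\<open>asymptotic_entropy_geI\<close>).  By the same equation the mean length grows in one step by \<open>(1 - z) / z\<close>
  times the mean length of \<open>p\<close>, which is at least \<open>l\<close> by subadditivity (\<open>moment_stopped_walk_ge\<close>).
\<close>

section \<open>Logarithmic differences and hyperbolic tangent lines\<close>

lemma real_le_sinh: "(t::real) \<le> sinh t" if "0 \<le> t"
proof -
  have "(\<lambda>u. sinh u - u) 0 \<le> (\<lambda>u. sinh u - u) t"
  proof (rule DERIV_nonneg_imp_nondecreasing[OF that])
    fix u :: real
    assume "0 \<le> u" "u \<le> t"
    show "\<exists>y. ((\<lambda>u. sinh u - u) has_real_derivative y) (at u) \<and> 0 \<le> y"
      by (rule exI[of _ "cosh u - 1"]) (auto intro!: derivative_eq_intros simp: cosh_real_ge_1)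
  qed
  then show ?thesis by simp
qed

text \<open>
  The derivative of \<open>t coth t\<close> is \<open>(sinh t cosh t - t) / sinh\<^sup>2 t\<close>.  Its sign is what makes both
  tangent lines below lie under their curves.
\<close>
lemma real_mult_coth_mono:
  fixes s t :: real
  assumes "0 < s" "s \<le> t"
  shows "s * cosh s / sinh s \<le> t * cosh t / sinh t"
proof (rule DERIV_nonneg_imp_nondecreasing[OF assms(2)])
  fix u :: real
  assume u: "s \<le> u" "u \<le> t"
  then have pos: "0 < u" "0 < sinh u" using assms by auto
  let ?y = "((cosh u + u * sinh u) * sinh u - u * cosh u * cosh u) / (sinh u * sinh u)"
  have "u * 1 \<le> sinh u * cosh u"
    using real_le_sinh[of u] pos cosh_real_ge_1[of u] by (intro mult_mono) auto
  moreover have "(cosh u + u * sinh u) * sinh u - u * cosh u * cosh u = sinh u * cosh u - u"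
    using cosh_square_eq[of u] by (simp add: algebra_simps power2_eq_square)
  ultimately have "0 \<le> ?y" using pos by simp
  moreover have "((\<lambda>u. u * cosh u / sinh u) has_real_derivative ?y) (at u)"
    using pos by (auto intro!: derivative_eq_intros simp: algebra_simps)
  ultimately show "\<exists>y. ((\<lambda>u. u * cosh u / sinh u) has_real_derivative y) (at u) \<and> 0 \<le> y"
    by blast
qed

lemma minimum_of_derivative_sign:
  fixes F F' :: "real \<Rightarrow> real"
  assumes deriv: "\<And>t. 0 \<le> t \<Longrightarrow> (F has_real_derivative F' t) (at t)"
    and neg: "\<And>t. 0 < t \<Longrightarrow> t \<le> s \<Longrightarrow> F' t \<le> 0"
    and pos: "\<And>t. s \<le> t \<Longrightarrow> 0 \<le> F' t"
    and zero: "F' 0 = 0" and "0 \<le> s" "0 \<le> t"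
  shows "F s \<le> F t"
proof (cases "s \<le> t")
  case True
  show ?thesis
  proof (rule DERIV_nonneg_imp_nondecreasing[OF True])
    fix u assume "s \<le> u" "u \<le> t"
    with \<open>0 \<le> s\<close> deriv[of u] pos[of u] show "\<exists>y. (F has_real_derivative y) (at u) \<and> 0 \<le> y"
      by auto
  qed
next
  case False
  then have "t \<le> s" by simp
  show ?thesis
  proof (rule DERIV_nonpos_imp_nonincreasing[OF \<open>t \<le> s\<close>])
    fix u assume "t \<le> u" "u \<le> s"
    with \<open>0 \<le> t\<close> neg[of u] zero show "\<exists>y. (F has_real_derivative y) (at u) \<and> y \<le> 0"
      by (intro exI[of _ "F' u"]) (use deriv[of u] in \<open>cases "u = 0"; auto\<close>)
  qed
qed

text \<open>
  In terms of \<open>c = 1 / cosh t\<close>, the function \<open>2 t tanh t\<close> is convex, and dividing the inequality by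
  \<open>cosh t\<close> gives its tangent line at \<open>t = s\<close>.  The difference of the two sides has derivative
  \<open>2 sinh t (t coth t - s coth s)\<close> in \<open>t\<close>, so it is minimal at \<open>t = s\<close>, where it vanishes.
\<close>
lemma cosh_tangent_bound:
  fixes s t :: real
  assumes "0 < s"
  shows "(2 + 2 * (s * cosh s / sinh s)) * cosh t - 2 * (cosh s + s / sinh s) \<le> 2 * (t * sinh t)"
proof -
  define c where "c = s * cosh s / sinh s"
  define F where "F t = 2 * (t * sinh t) - (2 + 2 * c) * cosh t" for t
  have [simp]: "sinh s \<noteq> 0" using assms by simp
  have D: "(F has_real_derivative 2 * (t * cosh t - c * sinh t)) (at t)" for t
    unfolding F_def by (auto intro!: derivative_eq_intros simp: algebra_simps)
  have "F s \<le> F \<bar>t\<bar>"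
  proof (rule minimum_of_derivative_sign[where F = F and s = s and F' = "\<lambda>t. 2 * (t * cosh t - c * sinh t)"])
    fix u :: real
    show "2 * (u * cosh u - c * sinh u) \<le> 0" if "0 < u" "u \<le> s"
      using real_mult_coth_mono[OF that] that by (simp add: c_def[symmetric] pos_divide_le_eq)
    show "0 \<le> 2 * (u * cosh u - c * sinh u)" if "s \<le> u"
      using real_mult_coth_mono[OF assms that] that assms
      by (simp add: c_def[symmetric] pos_le_divide_eq)
  qed (use D assms in auto)
  moreover have "F \<bar>t\<bar> = F t" by (simp add: F_def abs_if)
  moreover have "F s = - 2 * (cosh s + s / sinh s)"
  proof -
    have "c * cosh s = s * (1 + sinh s ^ 2) / sinh s"
      using cosh_square_eq[of s] by (simp add: c_def power2_eq_square)
    also have "\<dots> = s / sinh s + s * sinh s"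
      by (simp add: distrib_left add_divide_distrib power2_eq_square)
    finally have "c * cosh s = s / sinh s + s * sinh s" .
    then have "(2 + 2 * c) * cosh s = 2 * cosh s + 2 * (s / sinh s + s * sinh s)"
      by (simp add: distrib_right mult.assoc)
    then show ?thesis unfolding F_def by simp
  qed
  ultimately show ?thesis unfolding F_def c_def[symmetric] by linarith
qed

text \<open>
  The same function \<open>2 t tanh t\<close> is also convex in the variable \<open>tanh\<^sup>2 t\<close>, and \<open>k\<close> is its slope at
  \<open>t = s\<close>.  Here the sign of the derivative of the difference is that of
  \<open>cosh\<^sup>2 t + t coth t - k\<close>, which increases with \<open>t\<close> and vanishes at \<open>s\<close>.
\<close>
lemma tanh_tangent_bound:
  fixes s t :: real
  assumes "0 < s"
  defines "k \<equiv> (cosh s)\<^sup>2 + s * cosh s / sinh s"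
  shows "2 * (s * tanh s) + k * ((tanh t)\<^sup>2 - (tanh s)\<^sup>2) \<le> 2 * (t * tanh t)"
proof -
  define F where "F t = 2 * (t * tanh t) - k * (tanh t)\<^sup>2" for t
  define F' where "F' t = 2 / (cosh t)\<^sup>2 * (sinh t * cosh t + t - k * tanh t)" for t
  have sech: "1 - (tanh t)\<^sup>2 = 1 / (cosh t)\<^sup>2" for t :: real
  proof -
    have "1 + (sinh t)\<^sup>2 \<noteq> 0" by (smt (verit) zero_le_power2)
    then show ?thesis using cosh_square_eq[of t] by (simp add: tanh_def power_divide field_simps)
  qed
  have D: "(F has_real_derivative F' t) (at t)" for t
  proof -
    have "(F has_real_derivative 2 * (tanh t + t * (1 - (tanh t)\<^sup>2))
             - k * (2 * tanh t * (1 - (tanh t)\<^sup>2))) (at t)"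
      unfolding F_def by (auto intro!: derivative_eq_intros simp: algebra_simps)
    also have "2 * (tanh t + t * (1 - (tanh t)\<^sup>2)) - k * (2 * tanh t * (1 - (tanh t)\<^sup>2)) = F' t"
      unfolding F'_def sech by (simp add: tanh_def field_simps power2_eq_square)
    finally show ?thesis .
  qed
  have F'_eq: "F' u = 2 / (cosh u)\<^sup>2 * (tanh u * ((cosh u)\<^sup>2 + u * cosh u / sinh u - k))"
    if "0 < u" for u
    using that by (simp add: F'_def tanh_def field_simps power2_eq_square)
  have "F s \<le> F \<bar>t\<bar>"
  proof (rule minimum_of_derivative_sign[where F = F and s = s and F' = F'])
    fix u :: real
    show "F' u \<le> 0" if "0 < u" "u \<le> s"
    proof -
      have "(cosh u)\<^sup>2 \<le> (cosh s)\<^sup>2"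
        using that cosh_real_nonneg_le_iff[of u s] by (intro power_mono) auto
      with real_mult_coth_mono[OF that] have "(cosh u)\<^sup>2 + u * cosh u / sinh u - k \<le> 0"
        unfolding k_def by linarith
      then show ?thesis using that unfolding F'_eq[OF that(1)]
        by (intro mult_nonneg_nonpos) auto
    qed
    show "0 \<le> F' u" if "s \<le> u"
    proof -
      have "0 < u" using that assms by simp
      have "(cosh s)\<^sup>2 \<le> (cosh u)\<^sup>2"
        using that assms cosh_real_nonneg_le_iff[of s u] by (intro power_mono) auto
      with real_mult_coth_mono[OF assms(1) that]
      have "0 \<le> (cosh u)\<^sup>2 + u * cosh u / sinh u - k"
        unfolding k_def by linarith
      then show ?thesis using \<open>0 < u\<close> unfolding F'_eq[OF \<open>0 < u\<close>]
        by (intro mult_nonneg_nonneg) auto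
    qed
  qed (use D assms in \<open>auto simp: F'_def\<close>)
  moreover have "F \<bar>t\<bar> = F t" by (simp add: F_def abs_if)
  ultimately show ?thesis by (simp add: F_def algebra_simps)
qed

lemma hyperbolic_coordinates:
  fixes a b :: real
  assumes "0 < a" "0 < b"
  defines "t \<equiv> (ln a - ln b) / 2"
  shows "a - b = 2 * sqrt (a * b) * sinh t" "a + b = 2 * sqrt (a * b) * cosh t"
proof -
  have r: "sqrt (a * b) = exp ((ln a + ln b) / 2)"
  proof -
    have "(ln a + ln b) / 2 = ln (sqrt (a * b))" using assms by (simp add: ln_sqrt ln_mult)
    then show ?thesis using assms by simp
  qed
  have "sqrt (a * b) * exp t = a" "sqrt (a * b) * exp (- t) = b"
    using assms unfolding r by (auto simp: t_def exp_add[symmetric] field_simps)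
  then show "a - b = 2 * sqrt (a * b) * sinh t" "a + b = 2 * sqrt (a * b) * cosh t"
    by (auto simp: sinh_def cosh_def algebra_simps)
qed

text \<open>
  With \<open>t = (ln a - ln b) / 2\<close>, the quotient of \<open>(a - b) (ln a - ln b)\<close> by \<open>a + b\<close> is \<open>2 t tanh t\<close>, and
  \<open>2 \<surd>(a b) / (a + b)\<close> is \<open>1 / cosh t\<close>.  So this is the tangent line in \<open>1 / cosh t\<close>, in a form that is
  linear in quantities that can be summed over pairs of group elements.
\<close>
lemma log_difference_ge_geometric_mean:
  fixes a b s :: real
  assumes "0 < a" "0 < b" "0 < s"
  shows "(2 + 2 * (s * cosh s / sinh s)) * (a + b) - 4 * (cosh s + s / sinh s) * sqrt (a * b)
         \<le> (a - b) * (ln a - ln b)"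
proof -
  define t where "t = (ln a - ln b) / 2"
  define r where "r = sqrt (a * b)"
  have r: "0 \<le> r" using assms by (simp add: r_def)
  have ab: "a - b = 2 * r * sinh t" "a + b = 2 * r * cosh t"
    using hyperbolic_coordinates[OF assms(1,2)] by (auto simp: t_def r_def)
  have "2 * r * ((2 + 2 * (s * cosh s / sinh s)) * cosh t - 2 * (cosh s + s / sinh s))
         \<le> 2 * r * (2 * (t * sinh t))"
    using cosh_tangent_bound[OF assms(3)] r by (intro mult_left_mono) auto
  moreover have "ln a - ln b = 2 * t" by (simp add: t_def)
  ultimately show ?thesis unfolding ab r_def[symmetric] by (simp add: algebra_simps)
qed

text \<open>
  The tangent line in \<open>tanh\<^sup>2 t = (a - b)\<^sup>2 / (a + b)\<^sup>2\<close>.  The quadratic term \<open>(a - b)\<^sup>2 / (a + b)\<close> is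
  replaced by a linear one by completing a square; the free weight \<open>w\<close> does the work of the
  Cauchy--Schwarz inequality once the bound is summed.
\<close>
lemma log_difference_ge_weighted_difference:
  fixes a b s w :: real
  assumes "0 < a" "0 < b" "0 < s"
  defines "k \<equiv> (cosh s)\<^sup>2 + s * cosh s / sinh s"
  shows "(2 * (s * tanh s) - k * (tanh s)\<^sup>2 * (1 + w\<^sup>2)) * (a + b) + 2 * k * tanh s * (w * (a - b))
         \<le> (a - b) * (ln a - ln b)"
proof -
  define t where "t = (ln a - ln b) / 2"
  define r where "r = sqrt (a * b)"
  have r: "0 \<le> r" using assms by (simp add: r_def)
  have ab: "a - b = 2 * r * sinh t" "a + b = 2 * r * cosh t"
    using hyperbolic_coordinates[OF assms(1,2)] by (auto simp: t_def r_def)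
  have th: "(a + b) * tanh t = a - b" unfolding ab by (simp add: tanh_def)
  have k: "0 \<le> k" using assms by (auto simp: k_def)
  \<comment> \<open>This bounds \<open>tanh\<^sup>2 t\<close> below by its tangent line at \<open>tanh t = w tanh s\<close>.\<close>
  have "0 \<le> k * (a + b) * (tanh t - w * tanh s)\<^sup>2"
    using k assms by auto
  also have "\<dots> = (a + b) * k * (tanh t)\<^sup>2 + k * (tanh s)\<^sup>2 * w\<^sup>2 * (a + b)
                  - 2 * k * tanh s * w * ((a + b) * tanh t)"
    by (simp add: power2_eq_square algebra_simps)
  finally have "2 * k * tanh s * w * (a - b) - k * (tanh s)\<^sup>2 * w\<^sup>2 * (a + b)
      \<le> (a + b) * k * (tanh t)\<^sup>2" unfolding th by simp
  moreover have "(a + b) * (2 * (s * tanh s) + k * ((tanh t)\<^sup>2 - (tanh s)\<^sup>2))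
      \<le> (a + b) * (2 * (t * tanh t))"
    using tanh_tangent_bound[OF assms(3), of t] assms(1,2) by (intro mult_left_mono) (auto simp: k_def)
  moreover have "(a + b) * (2 * (t * tanh t)) = (a - b) * (ln a - ln b)"
  proof -
    have "(a + b) * (2 * (t * tanh t)) = ((a + b) * tanh t) * (2 * t)" by simp
    also have "\<dots> = (a - b) * (ln a - ln b)" unfolding th by (simp add: t_def)
    finally show ?thesis .
  qed
  ultimately show ?thesis by (simp add: algebra_simps)
qed

section \<open>Subadditive sequences\<close>

text \<open>
  Fekete's lemma: the limit is the infimum of the quotients, which also gives the lower bound
  \<open>n l \<le> u n\<close> for every single \<open>n\<close>.
\<close>
lemma subadditive_quotient_limit:
  fixes u :: "nat \<Rightarrow> real"
  assumes sub: "\<And>m n. u (m + n) \<le> u m + u n" and nonneg: "\<And>n. 0 \<le> u n"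
  obtains l where "(\<lambda>n. u n / real n) \<longlonglongrightarrow> l" "\<And>n. real n * l \<le> u n" "0 \<le> l"
proof -
  define l where "l = (INF n\<in>{1..}. u n / real n)"
  have bdd: "bdd_below ((\<lambda>n. u n / real n) ` {1..})"
    by (rule bdd_belowI2[of _ 0]) (auto simp: nonneg)
  have le: "l \<le> u n / real n" if "1 \<le> n" for n
    unfolding l_def using that bdd by (intro cINF_lower) auto
  have mult: "u (q * m) \<le> real q * u m" if "1 \<le> q" for q m
    using that
  proof (induction q rule: nat_induct_at_least)
    case (Suc n)
    then show ?case using sub[of m "n * m"] by (simp add: algebra_simps)
  qed simp
  have "(\<lambda>n. u n / real n) \<longlonglongrightarrow> l"
  proof (rule LIMSEQ_I)
    fix e :: real assume "0 < e"
    have "l < l + e / 2" using \<open>0 < e\<close> by simp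
    then obtain m where m: "1 \<le> m" "u m / real m < l + e / 2"
      unfolding l_def using cINF_less_iff[OF _ bdd] by (metis atLeast_iff empty_iff order_refl)
    define B where "B = (\<Sum>r<m. u r)"
    have B: "u r \<le> B" if "r < m" for r
      unfolding B_def using that nonneg by (intro member_le_sum) auto
    obtain N where N: "real N > 2 * B / e" using reals_Archimedean2 by blast
    show "\<exists>no. \<forall>n\<ge>no. norm (u n / real n - l) < e"
    proof (intro exI allI impI)
      fix n assume n: "max (max 1 m) N \<le> n"
      then have "1 \<le> n div m" using m div_le_mono[of m n m] by simp
      have "u n = u (n div m * m + n mod m)" by simp
      also have "\<dots> \<le> real (n div m) * u m + B"
        using sub[of "n div m * m" "n mod m"] mult[OF \<open>1 \<le> n div m\<close>, of m] B[of "n mod m"] m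
        by fastforce
      also have "real (n div m) * u m \<le> real n / real m * u m"
        using nonneg[of m] of_nat_div_le_of_nat[of n m, where ?'a = real] by (intro mult_right_mono) auto
      finally have "u n / real n \<le> (real n / real m * u m + B) / real n"
        by (intro divide_right_mono) auto
      also have "\<dots> = u m / real m + B / real n" using n by (simp add: add_divide_distrib)
      also have "B / real n < e / 2"
      proof -
        have "2 * B / e < real n" using N n by linarith
        then show ?thesis using \<open>0 < e\<close> n by (simp add: field_simps)
      qed
      finally have "u n / real n < l + e" using m by linarith
      with le[of n] n show "norm (u n / real n - l) < e" by auto
    qed
  qed
  moreover have "real n * l \<le> u n" for n
    using le[of n] nonneg[of 0] by (cases "n = 0") (auto simp: field_simps)
  moreover have "0 \<le> l" unfolding l_def by (intro cINF_greatest) (auto simp: nonneg)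
  ultimately show ?thesis by (rule that)
qed

section \<open>Sums over pairs and the Dirichlet form\<close>

lemma has_sum_diff_real:
  fixes f g :: "'a \<Rightarrow> real"
  assumes "(f has_sum a) A" "(g has_sum b) A"
  shows "((\<lambda>x. f x - g x) has_sum a - b) A"
  using has_sum_add[OF assms(1) has_sum_uminusI[OF assms(2)]] by simp

text \<open>
  Expectations of nonnegative functions are computed as nonnegative integrals, where iterated
  integrals need no summability, and are then turned into unconditional sums of real numbers.
\<close>
lemma nn_integral_pmf_infsum:
  fixes p :: "'a pmf" and f :: "'a \<Rightarrow> real"
  assumes "\<And>x. 0 \<le> f x" "(\<lambda>x. pmf p x * f x) summable_on UNIV"
  shows "(\<integral>\<^sup>+x. ennreal (f x) \<partial>p) = ennreal (\<Sum>\<^sub>\<infinity>x. pmf p x * f x)"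
proof -
  have "Infinite_Set_Sum.abs_summable_on (\<lambda>x. pmf p x * f x) UNIV"
    unfolding abs_summable_equivalent[symmetric] using assms by (simp add: abs_mult)
  then have "(\<integral>\<^sup>+x. ennreal (pmf p x * f x) \<partial>count_space UNIV)
               = ennreal (\<Sum>\<^sub>\<infinity>x. pmf p x * f x)"
    using assms by (simp add: nn_integral_conv_infsetsum infsetsum_infsum)
  then show ?thesis using assms by (simp add: nn_integral_measure_pmf ennreal_mult)
qed

lemma has_sum_pmf_nn_integral:
  fixes p :: "'a pmf" and f :: "'a \<Rightarrow> real"
  assumes "\<And>x. 0 \<le> f x" "(\<integral>\<^sup>+x. ennreal (f x) \<partial>p) = ennreal c" "0 \<le> c"
  shows "((\<lambda>x. pmf p x * f x) has_sum c) UNIV"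
proof -
  have eq: "(\<integral>\<^sup>+x. ennreal (pmf p x * f x) \<partial>count_space UNIV) = ennreal c"
    using assms by (simp add: nn_integral_measure_pmf ennreal_mult)
  then have "Infinite_Set_Sum.abs_summable_on (\<lambda>x. pmf p x * f x) UNIV"
    unfolding Infinite_Set_Sum.abs_summable_on_def using assms(1)
    by (simp add: integrable_iff_bounded abs_mult)
  then have summable: "(\<lambda>x. pmf p x * f x) summable_on UNIV"
    using assms(1) unfolding abs_summable_equivalent[symmetric] by (simp add: abs_mult)
  have "ennreal (\<Sum>\<^sub>\<infinity>x. pmf p x * f x) = ennreal c"
    using nn_integral_pmf_infsum[OF assms(1) summable] assms(2) by simp
  moreover have "0 \<le> (\<Sum>\<^sub>\<infinity>x. pmf p x * f x)"
    using assms(1) by (intro infsum_nonneg) auto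
  ultimately have "(\<Sum>\<^sub>\<infinity>x. pmf p x * f x) = c" using assms(3) by simp
  then show ?thesis using has_sum_infsum[OF summable] by simp
qed

lemma has_sum_pmf_bounded:
  fixes p :: "'a pmf" and f :: "'a \<Rightarrow> real"
  assumes "\<And>x. 0 \<le> f x" "(\<integral>\<^sup>+x. ennreal (f x) \<partial>p) \<le> ennreal b"
  obtains c where "0 \<le> c" "(\<integral>\<^sup>+x. ennreal (f x) \<partial>p) = ennreal c"
    "((\<lambda>x. pmf p x * f x) has_sum c) UNIV"
proof -
  define c where "c = enn2real (\<integral>\<^sup>+x. ennreal (f x) \<partial>p)"
  have "(\<integral>\<^sup>+x. ennreal (f x) \<partial>p) = ennreal c"
    unfolding c_def using assms(2) by (metis ennreal_enn2real ennreal_less_top order_le_less_trans)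
  moreover have "0 \<le> c" by (simp add: c_def)
  ultimately show ?thesis using has_sum_pmf_nn_integral[of f p c] assms(1) that by blast
qed

lemma has_sum_pmf: "(pmf p has_sum 1) UNIV"
  using has_sum_pmf_nn_integral[of "\<lambda>_. 1" p 1] by (simp add: measure_pmf.emeasure_space_1)

lemma nn_integral_convolution_pmf:
  "(\<integral>\<^sup>+x. f x \<partial>convolution_pmf p q) = (\<integral>\<^sup>+x. \<integral>\<^sup>+y. f (x + y) \<partial>q \<partial>p)"
  by (simp add: convolution_pmf_def nn_integral_pair_pmf')

lemma has_sum_convolution_pmf:
  fixes p q :: "'a::group_add pmf"
  shows "((\<lambda>x. pmf p x * pmf q (- x + g)) has_sum pmf (convolution_pmf p q) g) UNIV"
proof (rule has_sum_pmf_nn_integral)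
  have "x + y = g \<longleftrightarrow> y = - x + g" for x y
    using add_minus_cancel[of x g] minus_add_cancel[of x y] by auto
  then have "indicator {g} (x + y) = (indicator {- x + g} y :: ennreal)" for x y
    by (simp add: indicator_def)
  then have "(\<integral>\<^sup>+x. ennreal (pmf q (- x + g)) \<partial>p) = (\<integral>\<^sup>+x. \<integral>\<^sup>+y. indicator {g} (x + y) \<partial>q \<partial>p)"
    by (simp add: emeasure_pmf_single)
  also have "\<dots> = (\<integral>\<^sup>+x. indicator {g} x \<partial>convolution_pmf p q)"
    by (rule nn_integral_convolution_pmf[symmetric])
  also have "\<dots> = ennreal (pmf (convolution_pmf p q) g)" by (simp add: emeasure_pmf_single)
  finally show "(\<integral>\<^sup>+x. ennreal (pmf q (- x + g)) \<partial>p) = ennreal (pmf (convolution_pmf p q) g)" .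
qed auto

lemma has_sum_kernel_left:
  fixes \<kappa> f :: "'a::group_add \<Rightarrow> real"
  assumes \<kappa>: "(\<kappa> has_sum S) UNIV" "\<And>g. 0 \<le> \<kappa> g" and f: "(f has_sum F) UNIV"
  shows "((\<lambda>(x, y). \<kappa> (- x + y) * f x) has_sum S * F) (UNIV \<times> UNIV)"
proof -
  have inner: "((\<lambda>y. \<kappa> (- x + y)) has_sum S) UNIV" for x
    using \<kappa>(1) by (subst has_sum_reindex_bij_witness[where i = "\<lambda>y. x + y" and j = "\<lambda>y. - x + y" and T = UNIV and h = \<kappa> and s' = S])
      auto
  have "(\<lambda>x. \<bar>f x\<bar>) summable_on UNIV"
    using f has_sum_imp_summable summable_on_iff_abs_summable_on_real by fastforce
  then have "(\<lambda>(x, y). \<kappa> (- x + y) * \<bar>f x\<bar>) summable_on UNIV \<times> UNIV"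
    using has_sum_cmult_left[OF inner] \<kappa>(2)
    by (intro summable_on_SigmaI[where g = "\<lambda>x. S * \<bar>f x\<bar>"] summable_on_cmult_right) auto
  then have "(\<lambda>(x, y). \<kappa> (- x + y) * f x) summable_on UNIV \<times> UNIV"
    using \<kappa>(2) by (subst summable_on_iff_abs_summable_on_real)
      (simp add: case_prod_unfold abs_mult)
  then show ?thesis
    using has_sum_cmult_left[OF inner] has_sum_cmult_right[OF f]
    by (intro has_sum_SigmaI[where g = "\<lambda>x. S * f x"]) auto
qed

lemma has_sum_kernel_right:
  fixes \<kappa> f :: "'a::group_add \<Rightarrow> real"
  assumes "(\<kappa> has_sum S) UNIV" "\<And>g. 0 \<le> \<kappa> g" "\<And>g. \<kappa> (- g) = \<kappa> g" "(f has_sum F) UNIV"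
  shows "((\<lambda>(x, y). \<kappa> (- x + y) * f y) has_sum S * F) (UNIV \<times> UNIV)"
proof -
  have "\<kappa> (- y + x) = \<kappa> (- x + y)" for x y
    using assms(3)[of "- x + y"] by (simp add: minus_add)
  then show ?thesis
    using has_sum_kernel_left[OF assms(1,2,4)] by (subst has_sum_swap) simp
qed

text \<open>
  Summing over \<open>x\<close> first turns \<open>pmf \<mu> (- x + y) * pmf p x\<close> into the convolution, so summability
  is needed against \<open>p * \<mu>\<close> only.
\<close>
lemma has_sum_kernel_convolution:
  fixes p \<mu> :: "'a::group_add pmf"
  assumes f: "((\<lambda>y. pmf (convolution_pmf p \<mu>) y * f y) has_sum B) UNIV"
  shows "((\<lambda>(x, y). pmf \<mu> (- x + y) * (pmf p x * f y)) has_sum B) (UNIV \<times> UNIV)"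
proof -
  have inner: "((\<lambda>x. pmf \<mu> (- x + y) * (pmf p x * c)) has_sum pmf (convolution_pmf p \<mu>) y * c) UNIV"
    for y c using has_sum_cmult_left[OF has_sum_convolution_pmf[of p \<mu> y], of c]
    by (simp add: mult_ac)
  have "(\<lambda>y. pmf (convolution_pmf p \<mu>) y * \<bar>f y\<bar>) summable_on UNIV"
    using has_sum_imp_summable[OF f] by (subst (asm) summable_on_iff_abs_summable_on_real) (simp add: abs_mult)
  then have "(\<lambda>(y, x). pmf \<mu> (- x + y) * (pmf p x * \<bar>f y\<bar>)) summable_on UNIV \<times> UNIV"
    using inner by (intro summable_on_SigmaI[where g = "\<lambda>y. pmf (convolution_pmf p \<mu>) y * \<bar>f y\<bar>"]) auto
  then have "(\<lambda>(y, x). pmf \<mu> (- x + y) * (pmf p x * f y)) summable_on UNIV \<times> UNIV"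
    by (subst summable_on_iff_abs_summable_on_real) (simp add: case_prod_unfold abs_mult)
  then have "((\<lambda>(y, x). pmf \<mu> (- x + y) * (pmf p x * f y)) has_sum B) (UNIV \<times> UNIV)"
    using inner f by (intro has_sum_SigmaI[where g = "\<lambda>y. pmf (convolution_pmf p \<mu>) y * f y"]) auto
  then show ?thesis by (subst has_sum_swap) simp
qed

text \<open>
  Summation by parts: the Dirichlet form of \<open>p\<close> and \<open>f\<close> measures how much one step of the walk
  changes the expectation of \<open>f\<close>.  Each of the four products is summed separately, and the symmetry of
  \<open>\<mu>\<close> identifies them in pairs.
\<close>
lemma has_sum_dirichlet_form:
  fixes p \<mu> :: "'a::group_add pmf" and f :: "'a \<Rightarrow> real"
  assumes "symmetric_pmf \<mu>"
    and A: "((\<lambda>x. pmf p x * f x) has_sum A) UNIV"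
    and B: "((\<lambda>x. pmf (convolution_pmf p \<mu>) x * f x) has_sum B) UNIV"
  shows "((\<lambda>(x, y). pmf \<mu> (- x + y) * ((pmf p x - pmf p y) * (f x - f y))) has_sum 2 * (A - B))
    (UNIV \<times> UNIV)"
proof -
  have sym: "pmf \<mu> (- g) = pmf \<mu> g" for g using assms(1) by (simp add: symmetric_pmf_def)
  have swap: "pmf \<mu> (- y + x) = pmf \<mu> (- x + y)" for x y
    using sym[of "- x + y"] by (simp add: minus_add)
  have 1: "((\<lambda>(x, y). pmf \<mu> (- x + y) * (pmf p x * f x)) has_sum A) (UNIV \<times> UNIV)"
    using has_sum_kernel_left[OF has_sum_pmf _ A] by simp
  have 2: "((\<lambda>(x, y). pmf \<mu> (- x + y) * (pmf p y * f y)) has_sum A) (UNIV \<times> UNIV)"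
    using has_sum_kernel_right[OF has_sum_pmf _ sym A] by simp
  have 3: "((\<lambda>(x, y). pmf \<mu> (- x + y) * (pmf p x * f y)) has_sum B) (UNIV \<times> UNIV)"
    by (rule has_sum_kernel_convolution[OF B])
  have 4: "((\<lambda>(x, y). pmf \<mu> (- x + y) * (pmf p y * f x)) has_sum B) (UNIV \<times> UNIV)"
    using 3 by (subst has_sum_swap) (simp add: swap)
  show ?thesis
    using has_sum_diff_real[OF has_sum_diff_real[OF has_sum_add[OF 1 2] 3] 4]
    by (simp add: case_prod_unfold algebra_simps)
qed

section \<open>The walk at a geometric time\<close>

definition stopped_walk :: "real \<Rightarrow> 'a::group_add pmf \<Rightarrow> 'a pmf" where
  "stopped_walk z \<mu> = bind_pmf (geometric_pmf (1 - z)) (conv_power \<mu>)"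

lemma nn_integral_stopped_walk:
  "(\<integral>\<^sup>+x. f x \<partial>stopped_walk z \<mu>) = (\<integral>\<^sup>+n. \<integral>\<^sup>+x. f x \<partial>conv_power \<mu> n \<partial>geometric_pmf (1 - z))"
  by (simp add: stopped_walk_def)

text \<open>
  Conditioning on whether the geometric time is zero: \<open>p = (1 - z) \<delta>\<^sub>0 + z (p * \<mu>)\<close>.  Hence \<open>p\<close> is
  the resolvent of the walk, and \<open>p - p * \<mu> = (1 - z) / z (\<delta>\<^sub>0 - p)\<close> is small when \<open>z\<close> is close to \<open>1\<close>.
\<close>
lemma pmf_stopped_walk_renewal:
  fixes \<mu> :: "'a::group_add pmf"
  assumes "0 < z" "z < 1"
  shows "pmf (stopped_walk z \<mu>) x
    = (1 - z) * indicator {0} x + z * pmf (convolution_pmf (stopped_walk z \<mu>) \<mu>) x"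
proof -
  have "stopped_walk z \<mu> = bind_pmf (bernoulli_pmf (1 - z))
      (\<lambda>b. if b then return_pmf 0 else convolution_pmf (stopped_walk z \<mu>) \<mu>)"
    unfolding stopped_walk_def using assms
    by (subst geometric_bind_pmf_unfold)
      (auto simp: bind_assoc_pmf bind_return_pmf bind_map_pmf convolution_pmf_def pair_pmf_def
        map_bind_pmf map_pmf_def if_distrib intro!: bind_pmf_cong)
  also have "pmf \<dots> x = (1 - z) * indicator {0} x + z * pmf (convolution_pmf (stopped_walk z \<mu>) \<mu>) x"
    using assms by (simp add: pmf_bind indicator_def)
  finally show ?thesis .
qed

lemma pmf_stopped_walk_ge:
  assumes "0 < z" "z < 1"
  shows "(1 - z) * z ^ n * pmf (conv_power \<mu> n) x \<le> pmf (stopped_walk z \<mu>) x"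
proof -
  let ?G = "geometric_pmf (1 - z)"
  have "ennreal ((1 - z) * z ^ n * pmf (conv_power \<mu> n) x)
      = (\<integral>\<^sup>+k. ennreal (pmf (conv_power \<mu> n) x) * indicator {n} k \<partial>?G)"
    using assms
    by (subst nn_integral_cmult_indicator) (simp_all add: emeasure_pmf_single ennreal_mult'[symmetric] mult_ac)
  also have "\<dots> \<le> (\<integral>\<^sup>+k. ennreal (pmf (conv_power \<mu> k) x) \<partial>?G)"
    by (intro nn_integral_mono) (auto simp: indicator_def)
  also have "\<dots> = ennreal (pmf (stopped_walk z \<mu>) x)"
    by (simp add: stopped_walk_def ennreal_pmf_bind)
  finally show ?thesis by simp
qed

lemma nn_integral_geometric_affine:
  assumes "0 < z" "z < 1" "0 \<le> a" "0 \<le> b"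
  shows "(\<integral>\<^sup>+n. ennreal (a + b * real n) \<partial>geometric_pmf (1 - z)) = ennreal (a + b * (z / (1 - z)))"
proof -
  have p: "1 - z \<in> {0<..1}" using assms by simp
  note int = integrable_real_geometric_pmf[OF p] 
  have "(\<integral>\<^sup>+n. ennreal (a + b * real n) \<partial>geometric_pmf (1 - z))
     = ennreal (measure_pmf.expectation (geometric_pmf (1 - z)) (\<lambda>n. a + b * real n))"
    using int assms by (intro nn_integral_eq_integral) auto
  also have "measure_pmf.expectation (geometric_pmf (1 - z)) (\<lambda>n. a + b * real n) = a + b * (z / (1 - z))"
    using int expectation_geometric_pmf[OF p] by simp
  finally show ?thesis .
qed

text \<open>
  The renewal equation replaces the expectation of \<open>f\<close> under \<open>p * \<mu>\<close> by its expectation \<open>A\<close> under \<open>p\<close>.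
  The identity is used for \<open>f = ln p\<close>, where it produces the entropy, and for the length function,
  where it produces the drift.
\<close>
lemma has_sum_stopped_walk_dirichlet_form:
  fixes \<mu> :: "'a::group_add pmf" and f :: "'a \<Rightarrow> real"
  assumes "symmetric_pmf \<mu>" "0 < z" "z < 1"
  defines "p \<equiv> pmf (stopped_walk z \<mu>)"
  assumes A: "((\<lambda>x. p x * f x) has_sum A) UNIV"
  shows "((\<lambda>(x, y). pmf \<mu> (- x + y) * ((p x - p y) * (f x - f y)))
    has_sum 2 * ((1 - z) / z) * (f 0 - A)) (UNIV \<times> UNIV)"
proof -
  have 0: "((\<lambda>x. indicator {0} x * f x) has_sum f 0) UNIV"
    by (rule has_sum_finite_neutralI[where B = "{0}"]) (auto simp: indicator_def)
  have "((\<lambda>x. (p x * f x - (1 - z) * (indicator {0} x * f x)) / z)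
      has_sum (A - (1 - z) * f 0) / z) UNIV"
    using has_sum_cmult_left[OF has_sum_diff_real[OF A has_sum_cmult_right[OF 0, of "1 - z"]], of "inverse z"]
    by (simp add: divide_inverse)
  moreover have "(p x * f x - (1 - z) * (indicator {0} x * f x)) / z
      = pmf (convolution_pmf (stopped_walk z \<mu>) \<mu>) x * f x" for x
    using assms(2) unfolding p_def pmf_stopped_walk_renewal[OF assms(2,3), of \<mu> x]
    by (simp add: field_simps)
  ultimately have B: "((\<lambda>x. pmf (convolution_pmf (stopped_walk z \<mu>) \<mu>) x * f x)
      has_sum (A - (1 - z) * f 0) / z) UNIV" by simp
  have "2 * (A - (A - (1 - z) * f 0) / z) = 2 * ((1 - z) / z) * (f 0 - A)"
    using assms(2) by (simp add: field_simps)
  then show ?thesis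
    using has_sum_dirichlet_form[OF assms(1) A[unfolded p_def] B] by (simp add: p_def)
qed

section \<open>Entropy of convolution powers and of the stopped walk\<close>

lemma convolution_pmf_assoc:
  "convolution_pmf (convolution_pmf p q) r = convolution_pmf p (convolution_pmf q r)"
  by (simp add: convolution_pmf_def pair_pmf_def map_pmf_def bind_assoc_pmf bind_return_pmf add.assoc)

lemma convolution_return_0 [simp]:
  "convolution_pmf p (return_pmf 0) = p" "convolution_pmf (return_pmf 0) p = p"
  by (simp_all add: convolution_pmf_def pair_pmf_def map_pmf_def bind_assoc_pmf bind_return_pmf bind_return_pmf')

lemma conv_power_add:
  "conv_power \<mu> (m + n) = convolution_pmf (conv_power \<mu> m) (conv_power \<mu> n)"
  by (induction n) (simp_all add: convolution_pmf_assoc)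

lemma map_uminus_convolution_pmf:
  fixes p q :: "'a::group_add pmf"
  shows "map_pmf uminus (convolution_pmf p q)
    = convolution_pmf (map_pmf uminus q) (map_pmf uminus p)"
  by (subst (2) convolution_pmf_def, subst pair_commute_pmf)
    (simp add: convolution_pmf_def pair_map_pmf1 pair_map_pmf2 map_pmf_comp case_prod_unfold minus_add)

lemma symmetric_pmf_iff_map_uminus: "symmetric_pmf p \<longleftrightarrow> map_pmf uminus p = p"
proof -
  have "pmf (map_pmf uminus p) g = pmf p (- g)" for g :: 'a
    using pmf_map_inj'[of uminus p "- g"] by (simp add: inj_on_def)
  then show ?thesis by (auto simp: symmetric_pmf_def pmf_eq_iff)
qed

lemma symmetric_conv_power:
  assumes "symmetric_pmf \<mu>"
  shows "symmetric_pmf (conv_power \<mu> n)"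
proof -
  have "map_pmf uminus (conv_power \<mu> n) = conv_power \<mu> n"
  proof (induction n)
    case (Suc n)
    have "conv_power \<mu> (Suc n) = convolution_pmf \<mu> (conv_power \<mu> n)"
      using conv_power_add[of \<mu> "Suc 0" n] by simp
    then show ?case using Suc assms
      by (simp add: map_uminus_convolution_pmf symmetric_pmf_iff_map_uminus)
  qed simp
  then show ?thesis by (simp add: symmetric_pmf_iff_map_uminus)
qed

lemma pmf_convolution_ge: "pmf p x * pmf q y \<le> pmf (convolution_pmf p q) (x + y)"
  using finite_sum_le_has_sum[OF has_sum_convolution_pmf[of p q "x + y"], of "{x}"] by simp

lemma ln_pmf_le_0 [simp]: "ln (pmf p x) \<le> 0"
  by (cases "pmf p x = 0") (auto simp: pmf_le_1 pmf_nonneg less_le)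

lemma nn_integral_finite_entropy:
  fixes p :: "'a pmf"
  assumes "finite_entropy_pmf p"
  shows "(\<integral>\<^sup>+x. ennreal (- ln (pmf p x)) \<partial>p) = ennreal (entropy_pmf p)"
  using nn_integral_pmf_infsum[of "\<lambda>x. - ln (pmf p x)" p] assms
  by (simp add: finite_entropy_pmf_def entropy_pmf_def)

lemma entropy_pmf_nonneg: "0 \<le> entropy_pmf p"
  unfolding entropy_pmf_def by (intro infsum_nonneg) (simp add: mult_nonneg_nonpos)

lemma finite_entropy_pmfI:
  fixes p :: "'a pmf"
  assumes "(\<integral>\<^sup>+x. ennreal (- ln (pmf p x)) \<partial>p) \<le> ennreal b" "0 \<le> b"
  shows "finite_entropy_pmf p" "entropy_pmf p \<le> b"
proof -
  obtain c where c: "0 \<le> c" "(\<integral>\<^sup>+x. ennreal (- ln (pmf p x)) \<partial>p) = ennreal c"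
    "((\<lambda>x. pmf p x * - ln (pmf p x)) has_sum c) UNIV"
    by (rule has_sum_pmf_bounded[OF _ assms(1)]) auto
  then show "finite_entropy_pmf p"
    unfolding finite_entropy_pmf_def using has_sum_imp_summable by fastforce
  have "entropy_pmf p = c" unfolding entropy_pmf_def using infsumI[OF c(3)] by simp
  then show "entropy_pmf p \<le> b" using c assms by simp
qed

text \<open>
  Immediate from the pointwise bound \<open>(p * q) (x + y) \<ge> p x q y\<close>, after taking logarithms and
  averaging over independent \<open>x\<close> and \<open>y\<close>.
\<close>
lemma entropy_convolution_pmf_le:
  fixes p q :: "'a::group_add pmf"
  assumes "finite_entropy_pmf p" "finite_entropy_pmf q"
  shows "finite_entropy_pmf (convolution_pmf p q)"
    "entropy_pmf (convolution_pmf p q) \<le> entropy_pmf p + entropy_pmf q"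
proof -
  let ?c = "convolution_pmf p q"
  have "(\<integral>\<^sup>+x. ennreal (- ln (pmf ?c x)) \<partial>?c) = (\<integral>\<^sup>+x. \<integral>\<^sup>+y. ennreal (- ln (pmf ?c (x + y))) \<partial>q \<partial>p)"
    by (rule nn_integral_convolution_pmf)
  also have "\<dots> \<le> (\<integral>\<^sup>+x. \<integral>\<^sup>+y. ennreal (- ln (pmf p x)) + ennreal (- ln (pmf q y)) \<partial>q \<partial>p)"
  proof (intro nn_integral_mono_AE AE_pmfI)
    fix x y assume "x \<in> set_pmf p" "y \<in> set_pmf q"
    then have pos: "0 < pmf p x" "0 < pmf q y" by (auto simp: pmf_positive)
    then have "ln (pmf p x * pmf q y) \<le> ln (pmf ?c (x + y))"
      using pmf_convolution_ge[of p x q y] by (intro ln_mono) auto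
    then show "ennreal (- ln (pmf ?c (x + y))) \<le> ennreal (- ln (pmf p x)) + ennreal (- ln (pmf q y))"
      using pos by (auto simp: ln_mult ennreal_plus[symmetric] simp del: ennreal_plus intro!: ennreal_leI)
  qed
  also have "\<dots> = (\<integral>\<^sup>+x. ennreal (- ln (pmf p x)) \<partial>p) + (\<integral>\<^sup>+y. ennreal (- ln (pmf q y)) \<partial>q)"
    by (simp add: nn_integral_add measure_pmf.emeasure_space_1)
  also have "\<dots> = ennreal (entropy_pmf p + entropy_pmf q)"
    using assms by (simp add: nn_integral_finite_entropy entropy_pmf_nonneg)
  finally have le: "(\<integral>\<^sup>+x. ennreal (- ln (pmf ?c x)) \<partial>?c) \<le> ennreal (entropy_pmf p + entropy_pmf q)" .
  show "finite_entropy_pmf ?c" "entropy_pmf ?c \<le> entropy_pmf p + entropy_pmf q"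
    using finite_entropy_pmfI[OF le] by (simp_all add: entropy_pmf_nonneg)
qed

lemma finite_entropy_conv_power:
  assumes "finite_entropy_pmf \<mu>"
  shows "finite_entropy_pmf (conv_power \<mu> n)"
proof (induction n)
  case 0
  have "(\<lambda>g. - (pmf (return_pmf 0) g * ln (pmf (return_pmf 0) g))) = (\<lambda>g::'a. 0 :: real)"
    by (auto simp: pmf_return indicator_def)
  then show ?case by (simp add: finite_entropy_pmf_def)
qed (simp add: entropy_convolution_pmf_le assms)

lemma asymptotic_entropy_limit:
  assumes "finite_entropy_pmf \<mu>"
  shows "(\<lambda>n. entropy_pmf (conv_power \<mu> n) / real n) \<longlonglongrightarrow> asymptotic_entropy \<mu>"
    "0 \<le> asymptotic_entropy \<mu>"
proof -
  have "entropy_pmf (conv_power \<mu> (m + n)) \<le> entropy_pmf (conv_power \<mu> m) + entropy_pmf (conv_power \<mu> n)"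
    for m n unfolding conv_power_add
    by (intro entropy_convolution_pmf_le finite_entropy_conv_power assms)
  then obtain l where "(\<lambda>n. entropy_pmf (conv_power \<mu> n) / real n) \<longlonglongrightarrow> l" "0 \<le> l"
    using subadditive_quotient_limit[of "\<lambda>n. entropy_pmf (conv_power \<mu> n)"] entropy_pmf_nonneg by metis
  then show "(\<lambda>n. entropy_pmf (conv_power \<mu> n) / real n) \<longlonglongrightarrow> asymptotic_entropy \<mu>"
    "0 \<le> asymptotic_entropy \<mu>"
    by (simp_all add: asymptotic_entropy_def limI)
qed

text \<open>
  The stopped walk dominates \<open>(1 - z) z\<^sup>n\<close> times the \<open>n\<close>-th convolution power.  Taking logarithms, its
  entropy is at most the entropy of the geometric time plus the average of the entropies of the
  convolution powers; the mean of the geometric time is \<open>z / (1 - z)\<close>.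
\<close>
lemma entropy_stopped_walk_le:
  assumes \<mu>: "finite_entropy_pmf \<mu>" and z: "0 < z" "z < 1"
    and bound: "\<And>n. entropy_pmf (conv_power \<mu> n) \<le> C + b * real n" and nonneg: "0 \<le> C" "0 \<le> b"
  shows "finite_entropy_pmf (stopped_walk z \<mu>)"
    "entropy_pmf (stopped_walk z \<mu>) \<le> C - ln (1 - z) + (b - ln z) * (z / (1 - z))"
proof -
  let ?p = "stopped_walk z \<mu>" and ?G = "geometric_pmf (1 - z)"
  have "(\<integral>\<^sup>+x. ennreal (- ln (pmf ?p x)) \<partial>?p)
      = (\<integral>\<^sup>+n. \<integral>\<^sup>+x. ennreal (- ln (pmf ?p x)) \<partial>conv_power \<mu> n \<partial>?G)"
    by (rule nn_integral_stopped_walk)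
  also have "\<dots> \<le> (\<integral>\<^sup>+n. ennreal ((C - ln (1 - z)) + (b - ln z) * real n) \<partial>?G)"
  proof (intro nn_integral_mono)
    fix n
    let ?q = "conv_power \<mu> n"
    have "(\<integral>\<^sup>+x. ennreal (- ln (pmf ?p x)) \<partial>?q)
        \<le> (\<integral>\<^sup>+x. ennreal (- ln (1 - z) - real n * ln z) + ennreal (- ln (pmf ?q x)) \<partial>?q)"
    proof (intro nn_integral_mono_AE AE_pmfI)
      fix x assume "x \<in> set_pmf ?q"
      then have pos: "0 < pmf ?q x" by (simp add: pmf_positive)
      then have "ln ((1 - z) * z ^ n * pmf ?q x) \<le> ln (pmf ?p x)"
        using pmf_stopped_walk_ge[OF z, of n \<mu> x] z by (intro ln_mono) auto
      moreover have "ln ((1 - z) * z ^ n * pmf ?q x) = ln (1 - z) + real n * ln z + ln (pmf ?q x)"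
        using pos z by (simp add: ln_mult ln_realpow)
      moreover have "real n * ln z \<le> 0" using z by (simp add: mult_nonneg_nonpos)
      moreover have "ln (1 - z) \<le> 0" using z by simp
      ultimately show "ennreal (- ln (pmf ?p x))
          \<le> ennreal (- ln (1 - z) - real n * ln z) + ennreal (- ln (pmf ?q x))"
        by (auto simp: ennreal_plus[symmetric] simp del: ennreal_plus intro!: ennreal_leI)
    qed
    also have "\<dots> = ennreal (- ln (1 - z) - real n * ln z) + ennreal (entropy_pmf ?q)"
      by (simp add: nn_integral_add measure_pmf.emeasure_space_1 nn_integral_finite_entropy
          finite_entropy_conv_power[OF \<mu>])
    also have "\<dots> \<le> ennreal ((C - ln (1 - z)) + (b - ln z) * real n)"
    proof -
      have "real n * ln z \<le> 0" using z by (simp add: mult_nonneg_nonpos)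
      moreover have "ln (1 - z) \<le> 0" using z by simp
      ultimately show ?thesis using bound[of n]
        by (auto simp: ennreal_plus[symmetric] entropy_pmf_nonneg algebra_simps
            simp del: ennreal_plus intro!: ennreal_leI)
    qed
    finally show "(\<integral>\<^sup>+x. ennreal (- ln (pmf ?p x)) \<partial>?q) \<le> ennreal ((C - ln (1 - z)) + (b - ln z) * real n)" .
  qed
  also have "\<dots> = ennreal (C - ln (1 - z) + (b - ln z) * (z / (1 - z)))"
  proof (rule nn_integral_geometric_affine[OF z])
    have "ln (1 - z) \<le> 0" "ln z \<le> 0" using z by auto
    with nonneg show "0 \<le> C - ln (1 - z)" "0 \<le> b - ln z" by linarith+
  qed
  finally have le: "(\<integral>\<^sup>+x. ennreal (- ln (pmf ?p x)) \<partial>?p)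
      \<le> ennreal (C - ln (1 - z) + (b - ln z) * (z / (1 - z)))" .
  have "ln (1 - z) \<le> 0" "ln z \<le> 0" using z by auto
  with nonneg have "0 \<le> C - ln (1 - z)" "0 \<le> b - ln z" by linarith+
  then have "0 \<le> C - ln (1 - z) + (b - ln z) * (z / (1 - z))"
    using z by (intro add_nonneg_nonneg mult_nonneg_nonneg) auto
  with le show "finite_entropy_pmf ?p"
    "entropy_pmf ?p \<le> C - ln (1 - z) + (b - ln z) * (z / (1 - z))"
    using finite_entropy_pmfI by blast+
qed

lemma entropy_conv_power_affine_bound:
  assumes "finite_entropy_pmf \<mu>" "0 < e"
  obtains C where "0 \<le> C"
    "\<And>n. entropy_pmf (conv_power \<mu> n) \<le> C + (asymptotic_entropy \<mu> + e) * real n"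
proof -
  let ?h = "asymptotic_entropy \<mu>" and ?H = "\<lambda>n. entropy_pmf (conv_power \<mu> n)"
  have "\<forall>\<^sub>F n in sequentially. ?H n / real n < ?h + e"
    using order_tendstoD(2)[OF asymptotic_entropy_limit(1)[OF assms(1)]] assms(2) by simp
  then obtain N where N: "\<And>n. N \<le> n \<Longrightarrow> ?H n / real n < ?h + e"
    by (auto simp: eventually_sequentially)
  define C where "C = (\<Sum>n\<le>N. ?H n)"
  have C: "0 \<le> C" unfolding C_def by (intro sum_nonneg) (simp add: entropy_pmf_nonneg)
  have "?H n \<le> C + (?h + e) * real n" for n
  proof (cases "n \<le> N")
    case True
    then have "?H n \<le> C" unfolding C_def by (intro member_le_sum) (auto simp: entropy_pmf_nonneg)
    then show ?thesis using asymptotic_entropy_limit(2)[OF assms(1)] assms(2)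
      by (simp add: add_increasing2)
  next
    case False
    then have "?H n \<le> (?h + e) * real n" using N[of n] by (simp add: field_simps)
    then show ?thesis using C by simp
  qed
  with C show ?thesis by (rule that)
qed

lemma finite_entropy_stopped_walk:
  assumes "finite_entropy_pmf \<mu>" "0 < z" "z < 1"
  shows "finite_entropy_pmf (stopped_walk z \<mu>)"
proof -
  obtain C where "0 \<le> C"
    "\<And>n. entropy_pmf (conv_power \<mu> n) \<le> C + (asymptotic_entropy \<mu> + 1) * real n"
    using entropy_conv_power_affine_bound[OF assms(1), of 1] by auto
  then show ?thesis
    using entropy_stopped_walk_le(1)[OF assms] asymptotic_entropy_limit(2)[OF assms(1)] by fastforce
qed

text \<open>
  By the preceding bounds, \<open>(1 - z) / z\<close> times the entropy of the stopped walk is at most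
  \<open>h + \<epsilon>\<close> up to terms that vanish as \<open>z\<close> tends to \<open>1\<close>: the geometric time has mean
  \<open>z / (1 - z)\<close>, and its own entropy grows only logarithmically in \<open>1 / (1 - z)\<close>.
\<close>
lemma asymptotic_entropy_geI:
  assumes \<mu>: "finite_entropy_pmf \<mu>"
    and c: "\<And>z. 0 < z \<Longrightarrow> z < 1 \<Longrightarrow> c \<le> (1 - z) / z * entropy_pmf (stopped_walk z \<mu>)"
  shows "c \<le> asymptotic_entropy \<mu>"
proof (rule field_le_epsilon)
  fix e :: real assume "0 < e"
  define b where "b = asymptotic_entropy \<mu> + e"
  have b: "0 \<le> b" using asymptotic_entropy_limit(2)[OF \<mu>] \<open>0 < e\<close> by (simp add: b_def)
  obtain C where C: "0 \<le> C" "\<And>n. entropy_pmf (conv_power \<mu> n) \<le> C + b * real n"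
    using entropy_conv_power_affine_bound[OF \<mu> \<open>0 < e\<close>] by (auto simp: b_def)
  have "c \<le> (1 - z) / z * (C - ln (1 - z)) + (b - ln z)" if z: "0 < z" "z < 1" for z
  proof -
    have "c \<le> (1 - z) / z * entropy_pmf (stopped_walk z \<mu>)" using c[OF z] .
    also have "\<dots> \<le> (1 - z) / z * (C - ln (1 - z) + (b - ln z) * (z / (1 - z)))"
      using entropy_stopped_walk_le(2)[OF \<mu> z C(2) C(1) b] z by (intro mult_left_mono) auto
    also have "\<dots> = (1 - z) / z * (C - ln (1 - z)) + (b - ln z) * ((1 - z) / z * (z / (1 - z)))"
      by (simp only: distrib_left mult_ac)
    also have "(1 - z) / z * (z / (1 - z)) = 1" using z by simp
    finally show ?thesis by simp
  qed
  then have "\<forall>\<^sub>F z in at_left 1. c \<le> (1 - z) / z * (C - ln (1 - z)) + (b - ln z)"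
    by (intro eventually_at_leftI[of 0]) auto
  moreover have "((\<lambda>z::real. (1 - z) / z * (C - ln (1 - z)) + (b - ln z)) \<longlongrightarrow> b) (at_left 1)"
    by real_asymp
  ultimately have "c \<le> b" by (intro tendsto_lowerbound[of _ b "at_left 1"]) auto
  then show "c \<le> asymptotic_entropy \<mu> + e" by (simp add: b_def)
qed

section \<open>The spectral radius bounds the quadratic form of the walk\<close>

lemma sum_pmf_le_convolution_pmf:
  assumes "finite F"
  shows "(\<Sum>x\<in>F. pmf p x * pmf q (- x + g)) \<le> pmf (convolution_pmf p q) g"
  using assms by (intro finite_sum_le_has_sum[OF has_sum_convolution_pmf]) auto

text \<open>
  As \<open>p\<close> is symmetric, \<open>(p * p) g\<close> is the inner product of \<open>p\<close> with a translate of itself, and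
  \<open>(p * p) 0\<close> is the squared norm of \<open>p\<close>; so this is \<open>2 u v \<le> u\<^sup>2 + v\<^sup>2\<close> summed.
\<close>
lemma symmetric_convolution_square_le:
  assumes "symmetric_pmf p"
  shows "pmf (convolution_pmf p p) g \<le> pmf (convolution_pmf p p) 0"
proof -
  have sym: "pmf p (- x) = pmf p x" for x using assms by (simp add: symmetric_pmf_def)
  have sq: "((\<lambda>x. (pmf p x)\<^sup>2) has_sum pmf (convolution_pmf p p) 0) UNIV"
    using has_sum_convolution_pmf[of p p 0] by (simp add: sym power2_eq_square)
  moreover have "((\<lambda>x. (pmf p (- x + g))\<^sup>2) has_sum pmf (convolution_pmf p p) 0) UNIV"
    using sq by (subst has_sum_reindex_bij_witness[where i = "\<lambda>y. g - y" and j = "\<lambda>x. - x + g"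
          and T = UNIV and h = "\<lambda>x. (pmf p x)\<^sup>2"]) (auto simp: algebra_simps)
  ultimately have "((\<lambda>x. ((pmf p x)\<^sup>2 + (pmf p (- x + g))\<^sup>2) * (1 / 2)) has_sum
      (pmf (convolution_pmf p p) 0 + pmf (convolution_pmf p p) 0) * (1 / 2)) UNIV"
    by (intro has_sum_cmult_left has_sum_add)
  moreover have "pmf p x * pmf p (- x + g) \<le> ((pmf p x)\<^sup>2 + (pmf p (- x + g))\<^sup>2) * (1 / 2)" for x
    using sum_squares_bound[of "pmf p x" "pmf p (- x + g)"] by simp
  ultimately show ?thesis
    using has_sum_mono[OF has_sum_convolution_pmf[of p p g]] by fastforce
qed

text \<open>
  For the self-adjoint operator \<open>P\<close> of convolution by \<open>p\<close>, this is
  \<open>\<langle>f, P f\<rangle>\<^sup>2 \<le> \<langle>f, f\<rangle> \<langle>P f, P f\<rangle>\<close> with \<open>\<langle>P f, P f\<rangle> = \<langle>f, P\<^sup>2 f\<rangle>\<close>.  Since \<open>f\<close> is nonnegative and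
  supported in \<open>F\<close>, the norm of \<open>P f\<close> may be restricted to \<open>F\<close>, which keeps all sums finite.
\<close>
lemma quadratic_form_square_le:
  fixes f :: "'a::group_add \<Rightarrow> real"
  assumes p: "symmetric_pmf p" and F: "finite F" and f: "\<And>x. 0 \<le> f x"
  shows "(\<Sum>x\<in>F. \<Sum>y\<in>F. f x * f y * pmf p (- x + y))\<^sup>2
    \<le> (\<Sum>x\<in>F. (f x)\<^sup>2) * (\<Sum>x\<in>F. \<Sum>y\<in>F. f x * f y * pmf (convolution_pmf p p) (- x + y))"
proof -
  have sym: "pmf p (- x) = pmf p x" for x using p by (simp add: symmetric_pmf_def)
  define T where "T x = (\<Sum>y\<in>F. f y * pmf p (- x + y))" for x
  have "(\<Sum>x\<in>F. \<Sum>y\<in>F. f x * f y * pmf p (- x + y))\<^sup>2 = (\<Sum>x\<in>F. f x * T x)\<^sup>2"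
    by (simp add: T_def sum_distrib_left mult_ac)
  also have "\<dots> \<le> (\<Sum>x\<in>F. (f x)\<^sup>2) * (\<Sum>x\<in>F. (T x)\<^sup>2)"
    by (rule Cauchy_Schwarz_ineq_sum)
  also have "(\<Sum>x\<in>F. (T x)\<^sup>2) \<le> (\<Sum>y\<in>F. \<Sum>z\<in>F. f y * f z * pmf (convolution_pmf p p) (- y + z))"
  proof -
    have "(\<Sum>x\<in>F. (T x)\<^sup>2)
        = (\<Sum>x\<in>F. \<Sum>y\<in>F. \<Sum>z\<in>F. f y * f z * (pmf p (- x + y) * pmf p (- x + z)))"
      by (simp add: T_def power2_eq_square sum_product mult_ac)
    also have "\<dots> = (\<Sum>y\<in>F. \<Sum>x\<in>F. \<Sum>z\<in>F. f y * f z * (pmf p (- x + y) * pmf p (- x + z)))"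
      by (rule sum.swap)
    also have "\<dots> = (\<Sum>y\<in>F. \<Sum>z\<in>F. f y * f z * (\<Sum>x\<in>F. pmf p (- x + y) * pmf p (- x + z)))"
      by (rule sum.cong[OF refl], subst sum.swap, simp add: sum_distrib_left)
    also have "\<dots> \<le> (\<Sum>y\<in>F. \<Sum>z\<in>F. f y * f z * pmf (convolution_pmf p p) (- y + z))"
    proof (intro sum_mono mult_left_mono)
      fix y z
      have "(\<Sum>x\<in>F. pmf p (- x + y) * pmf p (- x + z))
          = (\<Sum>u\<in>(\<lambda>x. - y + x) ` F. pmf p u * pmf p (- u + (- y + z)))"
        using sym[of "- x + y" for x]
        by (subst sum.reindex) (auto simp: inj_on_def minus_add add.assoc)
      also have "\<dots> \<le> pmf (convolution_pmf p p) (- y + z)"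
        using F by (intro sum_pmf_le_convolution_pmf) auto
      finally show "(\<Sum>x\<in>F. pmf p (- x + y) * pmf p (- x + z)) \<le> pmf (convolution_pmf p p) (- y + z)" .
    qed (use f in simp)
    finally show ?thesis .
  qed
  finally show ?thesis by (simp add: mult_left_mono sum_nonneg)
qed

lemma limsup_return_probability:
  "limsup (\<lambda>n. ereal (root n (pmf (conv_power \<mu> n) 0))) = ereal (spectral_radius_pmf \<mu>)"
  "0 \<le> spectral_radius_pmf \<mu>" "spectral_radius_pmf \<mu> \<le> 1"
proof -
  let ?L = "limsup (\<lambda>n. ereal (root n (pmf (conv_power \<mu> n) 0)))"
  have "?L \<le> ereal 1"
    by (intro Limsup_bounded eventuallyI)
      (metis (no_types) ereal_less_eq(3) not_gr_zero pmf_le_1 real_root_le_1_iff root_0 zero_le_one)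
  moreover have "ereal 0 \<le> ?L"
    by (rule order_trans[OF _ Liminf_le_Limsup])
      (auto intro!: Liminf_bounded always_eventually simp: real_root_ge_zero)
  ultimately show "?L = ereal (spectral_radius_pmf \<mu>)"
    "0 \<le> spectral_radius_pmf \<mu>" "spectral_radius_pmf \<mu> \<le> 1"
    unfolding spectral_radius_pmf_def by (cases ?L; auto)+
qed

text \<open>
  Iterating the previous inequality bounds the \<open>2\<^sup>k\<close>-th power of \<open>\<langle>f, P f\<rangle> / \<langle>f, f\<rangle>\<close> by
  \<open>\<langle>f, P\<^sup>n f\<rangle> / \<langle>f, f\<rangle>\<close> with \<open>n = 2\<^sup>k\<close>, which is at most a constant times the return probability at
  time \<open>n\<close>.  The constant disappears on taking \<open>n\<close>-th roots.
\<close>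
lemma quadratic_form_le_spectral_radius:
  fixes f :: "'a::group_add \<Rightarrow> real" and \<mu> :: "'a pmf"
  assumes \<mu>: "symmetric_pmf \<mu>" and F: "finite F" and f: "\<And>x. 0 \<le> f x"
  shows "(\<Sum>x\<in>F. \<Sum>y\<in>F. f x * f y * pmf \<mu> (- x + y)) \<le> spectral_radius_pmf \<mu> * (\<Sum>x\<in>F. (f x)\<^sup>2)"
proof (cases "(\<Sum>x\<in>F. (f x)\<^sup>2) = 0")
  case True
  then have "f x = 0" if "x \<in> F" for x using F that by (simp add: sum_nonneg_eq_0_iff)
  then show ?thesis by simp
next
  case False
  define N where "N = (\<Sum>x\<in>F. (f x)\<^sup>2)"
  define Q where "Q n = (\<Sum>x\<in>F. \<Sum>y\<in>F. f x * f y * pmf (conv_power \<mu> n) (- x + y))" for n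
  define K where "K = (\<Sum>x\<in>F. f x)\<^sup>2 / N"
  have N: "0 < N" using False by (simp add: N_def sum_nonneg less_le)
  have Q: "0 \<le> Q n" for n using f by (auto simp: Q_def intro!: sum_nonneg)
  have K: "0 < K"
  proof -
    have "(\<Sum>x\<in>F. f x) \<noteq> 0"
      using False F f by (auto simp: sum_nonneg_eq_0_iff)
    then show ?thesis using N by (simp add: K_def)
  qed
  have double: "(Q n / N)\<^sup>2 \<le> Q (2 * n) / N" for n
  proof -
    have "(Q n)\<^sup>2 \<le> N * Q (2 * n)"
      using quadratic_form_square_le[OF symmetric_conv_power[OF \<mu>, of n] F f]
      by (simp add: Q_def N_def conv_power_add[symmetric] mult_2)
    then show ?thesis using N by (simp add: power_divide field_simps power2_eq_square)
  qed
  have powers: "(Q 1 / N) ^ (2 ^ k) \<le> Q (2 ^ k) / N" for k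
  proof (induction k)
    case (Suc k)
    have "(Q 1 / N) ^ (2 ^ Suc k) = ((Q 1 / N) ^ (2 ^ k))\<^sup>2"
      by (simp add: power_mult[symmetric] mult.commute)
    also have "\<dots> \<le> (Q (2 ^ k) / N)\<^sup>2" using Suc N Q by (intro power_mono) auto
    also have "\<dots> \<le> Q (2 ^ Suc k) / N" using double[of "2 ^ k"] by simp
    finally show ?case .
  qed simp
  have return: "Q (2 ^ Suc k) / N \<le> K * pmf (conv_power \<mu> (2 ^ Suc k)) 0" for k
  proof -
    have "Q (2 ^ Suc k) \<le> (\<Sum>x\<in>F. \<Sum>y\<in>F. f x * f y * pmf (conv_power \<mu> (2 ^ Suc k)) 0)"
      unfolding Q_def
      using symmetric_convolution_square_le[OF symmetric_conv_power[OF \<mu>, of "2 ^ k"]] f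
      by (intro sum_mono mult_left_mono) (auto simp: conv_power_add[symmetric] mult_2)
    also have "\<dots> = (\<Sum>x\<in>F. f x)\<^sup>2 * pmf (conv_power \<mu> (2 ^ Suc k)) 0"
      unfolding power2_eq_square sum_product by (simp only: sum_distrib_right)
    finally show ?thesis using N by (simp add: K_def divide_right_mono)
  qed
  have "Q 1 / N \<le> spectral_radius_pmf \<mu>"
  proof (rule field_le_epsilon)
    fix e :: real assume "0 < e"
    define r where "r = spectral_radius_pmf \<mu> + e"
    have "limsup (\<lambda>n. ereal (root n (pmf (conv_power \<mu> n) 0))) < ereal r"
      using \<open>0 < e\<close> by (simp add: limsup_return_probability r_def)
    then have ev: "\<forall>\<^sub>F n in sequentially. root n (pmf (conv_power \<mu> n) 0) < r"
      using Limsup_lessD by fastforce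
    have sub: "filterlim (\<lambda>k. 2 ^ Suc k :: nat) sequentially sequentially"
      by (rule filterlim_subseq) (auto simp: strict_mono_def intro: power_strict_increasing)
    have "\<forall>\<^sub>F k in sequentially. Q 1 / N \<le> root (2 ^ Suc k) K * r"
      using eventually_compose_filterlim[OF ev sub]
    proof eventually_elim
      case (elim k)
      let ?n = "2 ^ Suc k :: nat"
      have "(Q 1 / N) ^ ?n \<le> K * pmf (conv_power \<mu> ?n) 0"
        using powers[of "Suc k"] return[of k] by linarith
      then have "root ?n ((Q 1 / N) ^ ?n) \<le> root ?n (K * pmf (conv_power \<mu> ?n) 0)"
        by (intro real_root_le_mono) auto
      also have "\<dots> = root ?n K * root ?n (pmf (conv_power \<mu> ?n) 0)" by (rule real_root_mult)
      also have "\<dots> \<le> root ?n K * r" using elim K by (intro mult_left_mono) auto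
      also have "root ?n ((Q 1 / N) ^ ?n) = Q 1 / N"
        using Q[of 1] N by (intro real_root_power_cancel) auto
      finally show ?case .
    qed
    moreover have "(\<lambda>k. root (2 ^ Suc k) K * r) \<longlonglongrightarrow> 1 * r"
      using filterlim_compose[OF LIMSEQ_root_const[OF K] sub] by (intro tendsto_mult tendsto_const)
    ultimately have "Q 1 / N \<le> 1 * r"
      by (intro tendsto_lowerbound[of _ "1 * r" sequentially]) auto
    then show "Q 1 / N \<le> spectral_radius_pmf \<mu> + e" by (simp add: r_def)
  qed
  then show ?thesis using N by (simp add: Q_def N_def field_simps)
qed

text \<open>
  Testing the quadratic form on the indicator of \<open>{0, g}\<close>, for any \<open>g\<close> in the support of \<open>\<mu>\<close>.
\<close>
lemma spectral_radius_pos: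
  fixes \<mu> :: "'a::group_add pmf"
  assumes "symmetric_pmf \<mu>"
  shows "0 < spectral_radius_pmf \<mu>"
proof -
  obtain g where "g \<in> set_pmf \<mu>" using set_pmf_not_empty[of \<mu>] by blast
  then have "0 < pmf \<mu> g" by (simp add: pmf_positive)
  also have "pmf \<mu> g \<le> (\<Sum>y\<in>{0, g}. pmf \<mu> (- 0 + y))"
    using member_le_sum[of g "{0, g}" "\<lambda>y. pmf \<mu> (- 0 + y)"] by simp
  also have "\<dots> \<le> (\<Sum>x\<in>{0, g}. \<Sum>y\<in>{0, g}. pmf \<mu> (- x + y))"
    using member_le_sum[of 0 "{0, g}" "\<lambda>x. \<Sum>y\<in>{0, g}. pmf \<mu> (- x + y)"] by (simp add: sum_nonneg)
  also have "\<dots> \<le> spectral_radius_pmf \<mu> * real (card {0, g})"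
    using quadratic_form_le_spectral_radius[OF assms, of "{0, g}" "\<lambda>_. 1"] by simp
  finally show ?thesis by (rule zero_less_mult_pos2) (simp add: card_gt_0_iff)
qed

text \<open>
  The quadratic form at \<open>\<surd>p\<close>, which has norm \<open>1\<close>, approximated from below by finite sets.
\<close>
lemma has_sum_geometric_mean_le_spectral_radius:
  fixes \<mu> p :: "'a::group_add pmf"
  assumes "symmetric_pmf \<mu>"
  obtains c where "c \<le> spectral_radius_pmf \<mu>"
    "((\<lambda>(x, y). pmf \<mu> (- x + y) * sqrt (pmf p x * pmf p y)) has_sum c) (UNIV \<times> UNIV)"
proof -
  let ?f = "\<lambda>(x, y). pmf \<mu> (- x + y) * sqrt (pmf p x * pmf p y)"
  have sym: "pmf \<mu> (- g) = pmf \<mu> g" for g using assms by (simp add: symmetric_pmf_def)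
  have "((\<lambda>(x, y). pmf \<mu> (- x + y) * (pmf p x + pmf p y)) has_sum 1 + 1) (UNIV \<times> UNIV)"
    using has_sum_add[OF has_sum_kernel_left[OF has_sum_pmf _ has_sum_pmf, of \<mu> p]
        has_sum_kernel_right[OF has_sum_pmf _ sym has_sum_pmf, of p]]
    by (simp add: case_prod_unfold distrib_left)
  then have "?f summable_on UNIV \<times> UNIV"
  proof (rule summable_on_comparison_test[OF has_sum_imp_summable])
    have "sqrt (a * b) \<le> a + b" if "0 \<le> a" "0 \<le> b" for a b :: real
      using arith_geo_mean_sqrt[OF that] that by simp
    then show "?f u \<le> (\<lambda>(x, y). pmf \<mu> (- x + y) * (pmf p x + pmf p y)) u" for u
      by (auto simp: case_prod_unfold intro!: mult_left_mono)
  qed auto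
  then have sum: "(?f has_sum infsum ?f (UNIV \<times> UNIV)) (UNIV \<times> UNIV)" by (rule has_sum_infsum)
  have "infsum ?f (UNIV \<times> UNIV) \<le> spectral_radius_pmf \<mu>"
  proof (rule has_sum_le_finite_sums[OF sum])
    fix G :: "('a \<times> 'a) set" assume "finite G"
    define F where "F = fst ` G \<union> snd ` G"
    have F: "finite F" "G \<subseteq> F \<times> F" using \<open>finite G\<close> by (force simp: F_def)+
    have "sum ?f G \<le> sum ?f (F \<times> F)" using F by (intro sum_mono2) auto
    also have "\<dots> = (\<Sum>x\<in>F. \<Sum>y\<in>F. sqrt (pmf p x) * sqrt (pmf p y) * pmf \<mu> (- x + y))"
      by (simp add: sum.cartesian_product[symmetric] real_sqrt_mult mult_ac)
    also have "\<dots> \<le> spectral_radius_pmf \<mu> * (\<Sum>x\<in>F. (sqrt (pmf p x))\<^sup>2)"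
      using F by (intro quadratic_form_le_spectral_radius assms) auto
    also have "\<dots> \<le> spectral_radius_pmf \<mu> * 1"
      using F finite_sum_le_has_sum[OF has_sum_pmf[of p] F(1)] limsup_return_probability(2)
      by (intro mult_left_mono) auto
    finally show "sum ?f G \<le> spectral_radius_pmf \<mu>" by simp
  qed
  with sum show ?thesis by (rule that[rotated])
qed

section \<open>Entropy production against the spectral radius\<close>

text \<open>
  The pointwise inequalities need positive arguments.  By this equivalence, a pair with
  \<open>pmf \<mu> (- x + y) \<noteq> 0\<close> has both masses positive or both zero, and in the second case its terms vanish.
  One more step of the walk gives \<open>p y \<ge> z p x \<mu>(-x+y)\<close>, and \<open>\<mu>\<close> is symmetric.
\<close>
lemma pmf_stopped_walk_pos_iff:
  fixes \<mu> :: "'a::group_add pmf"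
  assumes "symmetric_pmf \<mu>" "0 < z" "z < 1" "0 < pmf \<mu> (- x + y)"
  shows "0 < pmf (stopped_walk z \<mu>) x \<longleftrightarrow> 0 < pmf (stopped_walk z \<mu>) y"
proof -
  have step: "z * (pmf (stopped_walk z \<mu>) a * pmf \<mu> (- a + b)) \<le> pmf (stopped_walk z \<mu>) b" for a b
    using pmf_stopped_walk_renewal[OF assms(2,3), of \<mu> b]
      pmf_convolution_ge[of "stopped_walk z \<mu>" a \<mu> "- a + b"] assms(2,3)
    by (simp add: add_increasing mult_left_mono)
  have "pmf \<mu> (- y + x) = pmf \<mu> (- (- x + y))" by (simp add: minus_add)
  then have "0 < pmf \<mu> (- y + x)" using assms(1,4) by (simp add: symmetric_pmf_def)
  then have "0 < pmf (stopped_walk z \<mu>) y" if "0 < pmf (stopped_walk z \<mu>) x"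
    using step[of x y] assms(2,4) that by (intro less_le_trans[OF _ step[of x y]]) simp
  moreover have "0 < pmf (stopped_walk z \<mu>) x" if "0 < pmf (stopped_walk z \<mu>) y"
    using \<open>0 < pmf \<mu> (- y + x)\<close> assms(2) that by (intro less_le_trans[OF _ step[of y x]]) simp
  ultimately show ?thesis by blast
qed

text \<open>
  The Dirichlet form of \<open>p\<close> and \<open>ln p\<close> equals \<open>2 (1 - z) / z (H p + ln (p 0))\<close>, and the last
  logarithm is nonpositive.
\<close>
lemma has_sum_stopped_walk_entropy_production:
  fixes \<mu> :: "'a::group_add pmf"
  assumes "symmetric_pmf \<mu>" "finite_entropy_pmf \<mu>" "0 < z" "z < 1"
  defines "p \<equiv> pmf (stopped_walk z \<mu>)"
  obtains D where "D \<le> 2 * ((1 - z) / z * entropy_pmf (stopped_walk z \<mu>))"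
    "((\<lambda>(x, y). pmf \<mu> (- x + y) * ((p x - p y) * (ln (p x) - ln (p y)))) has_sum D) (UNIV \<times> UNIV)"
proof (rule that)
  let ?H = "entropy_pmf (stopped_walk z \<mu>)"
  have "((\<lambda>x. - (p x * ln (p x))) has_sum ?H) UNIV"
    using finite_entropy_stopped_walk[OF assms(2,3,4)]
    unfolding finite_entropy_pmf_def entropy_pmf_def p_def by (rule has_sum_infsum)
  from has_sum_uminusI[OF this] have "((\<lambda>x. p x * ln (p x)) has_sum - ?H) UNIV" by simp
  from has_sum_stopped_walk_dirichlet_form[OF assms(1,3,4) this[unfolded p_def]]
  show "((\<lambda>(x, y). pmf \<mu> (- x + y) * ((p x - p y) * (ln (p x) - ln (p y))))
      has_sum 2 * ((1 - z) / z) * (ln (p 0) - - ?H)) (UNIV \<times> UNIV)"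
    by (simp add: p_def)
  have "2 * ((1 - z) / z) * (ln (p 0) - - ?H) \<le> 2 * ((1 - z) / z) * ?H"
    using assms(3,4) by (intro mult_left_mono) (auto simp: p_def)
  then show "2 * ((1 - z) / z) * (ln (p 0) - - ?H) \<le> 2 * ((1 - z) / z * ?H)"
    by (simp only: mult.assoc)
qed

text \<open>
  The first tangent line summed over all pairs.  By summing tangent lines, Jensen's inequality is
  avoided, and \<open>s\<close> is left free; the best choice is \<open>cosh s = 1 / \<rho>\<close>.
\<close>
lemma stopped_walk_entropy_ge_spectral:
  fixes \<mu> :: "'a::group_add pmf"
  assumes sym: "symmetric_pmf \<mu>" and fin: "finite_entropy_pmf \<mu>" and z: "0 < z" "z < 1" and s: "0 < s"
  shows "2 + 2 * (s * cosh s / sinh s) - 2 * (cosh s + s / sinh s) * spectral_radius_pmf \<mu>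
    \<le> (1 - z) / z * entropy_pmf (stopped_walk z \<mu>)"
proof -
  define p where "p = pmf (stopped_walk z \<mu>)"
  define A where "A = 2 + 2 * (s * cosh s / sinh s)"
  define m where "m = 2 * (cosh s + s / sinh s)"
  have m: "0 \<le> m" using s by (simp add: m_def add_nonneg_nonneg)
  have sym': "pmf \<mu> (- g) = pmf \<mu> g" for g using sym by (simp add: symmetric_pmf_def)
  obtain D where D: "D \<le> 2 * ((1 - z) / z * entropy_pmf (stopped_walk z \<mu>))"
    "((\<lambda>(x, y). pmf \<mu> (- x + y) * ((p x - p y) * (ln (p x) - ln (p y)))) has_sum D) (UNIV \<times> UNIV)"
    using has_sum_stopped_walk_entropy_production[OF sym fin z] unfolding p_def by blast
  obtain c where c: "c \<le> spectral_radius_pmf \<mu>"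
    "((\<lambda>(x, y). pmf \<mu> (- x + y) * sqrt (p x * p y)) has_sum c) (UNIV \<times> UNIV)"
    using has_sum_geometric_mean_le_spectral_radius[OF sym] unfolding p_def by blast
  have mass: "((\<lambda>(x, y). pmf \<mu> (- x + y) * p x) has_sum 1) (UNIV \<times> UNIV)"
    "((\<lambda>(x, y). pmf \<mu> (- x + y) * p y) has_sum 1) (UNIV \<times> UNIV)"
    using has_sum_kernel_left[OF has_sum_pmf _ has_sum_pmf, of \<mu> "stopped_walk z \<mu>"]
      has_sum_kernel_right[OF has_sum_pmf _ sym' has_sum_pmf, of "stopped_walk z \<mu>"]
    by (simp_all add: p_def)
  have "((\<lambda>u. A * (case u of (x, y) \<Rightarrow> pmf \<mu> (- x + y) * p x)
        + A * (case u of (x, y) \<Rightarrow> pmf \<mu> (- x + y) * p y)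
        - 2 * m * (case u of (x, y) \<Rightarrow> pmf \<mu> (- x + y) * sqrt (p x * p y)))
      has_sum A * 1 + A * 1 - 2 * m * c) (UNIV \<times> UNIV)"
    using mass c(2) by (intro has_sum_diff_real has_sum_add has_sum_cmult_right)
  then have "A * 1 + A * 1 - 2 * m * c \<le> D"
  proof (rule has_sum_mono[OF _ D(2)])
    fix u :: "'a \<times> 'a"
    obtain x y where u: "u = (x, y)" by (cases u)
    have "A * (p x + p y) - 2 * m * sqrt (p x * p y) \<le> (p x - p y) * (ln (p x) - ln (p y))"
      if "0 < pmf \<mu> (- x + y)"
    proof (cases "0 < p x")
      case True
      then have "0 < p y" using pmf_stopped_walk_pos_iff[OF sym z that] by (simp add: p_def)
      with True show ?thesis
        using log_difference_ge_geometric_mean[OF _ _ s] by (simp add: A_def m_def)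
    next
      case False
      then have "\<not> 0 < p y" using pmf_stopped_walk_pos_iff[OF sym z that] by (simp add: p_def)
      with False have "p x = 0" "p y = 0" by (auto simp: p_def not_less intro: order.antisym)
      then show ?thesis by simp
    qed
    then have "pmf \<mu> (- x + y) * (A * (p x + p y) - 2 * m * sqrt (p x * p y))
        \<le> pmf \<mu> (- x + y) * ((p x - p y) * (ln (p x) - ln (p y)))"
      by (cases "pmf \<mu> (- x + y) = 0") (auto intro!: mult_left_mono simp: pmf_pos)
    then show "A * (case u of (x, y) \<Rightarrow> pmf \<mu> (- x + y) * p x)
        + A * (case u of (x, y) \<Rightarrow> pmf \<mu> (- x + y) * p y)
        - 2 * m * (case u of (x, y) \<Rightarrow> pmf \<mu> (- x + y) * sqrt (p x * p y))
      \<le> (case u of (x, y) \<Rightarrow> pmf \<mu> (- x + y) * ((p x - p y) * (ln (p x) - ln (p y))))"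
      by (simp add: u algebra_simps)
  qed
  moreover have "m * c \<le> m * spectral_radius_pmf \<mu>" using c(1) m by (rule mult_left_mono)
  ultimately have "A - m * spectral_radius_pmf \<mu> \<le> (1 - z) / z * entropy_pmf (stopped_walk z \<mu>)"
    using D(1) by linarith
  then show ?thesis unfolding A_def m_def .
qed

section \<open>Entropy production against the drift\<close>

locale group_length =
  fixes len :: "'a::group_add \<Rightarrow> real"
  assumes len_add: "len (x + y) \<le> len x + len y"
    and len_minus: "len (- x) = len x"
    and len_0: "len 0 = 0"
begin

lemma len_nonneg: "0 \<le> len x"
  using len_add[of x "- x"] by (simp add: len_minus len_0)

lemma abs_len_diff_le: "\<bar>len x - len y\<bar> \<le> len (- x + y)"
proof -
  have "len y \<le> len x + len (- x + y)" using len_add[of x "- x + y"] by simp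
  moreover have "len x \<le> len y + len (- y + x)" using len_add[of y "- y + x"] by simp
  moreover have "len (- y + x) = len (- x + y)" using len_minus[of "- x + y"] by (simp add: minus_add)
  ultimately show ?thesis by linarith
qed

definition moment :: "'a pmf \<Rightarrow> real" where
  "moment p = (\<Sum>\<^sub>\<infinity>x. len x * pmf p x)"

definition finite_moment :: "'a pmf \<Rightarrow> bool" where
  "finite_moment p \<longleftrightarrow> (\<lambda>x. len x * pmf p x) summable_on UNIV"

lemma moment_nonneg: "0 \<le> moment p"
  unfolding moment_def by (intro infsum_nonneg) (simp add: len_nonneg)

lemma nn_integral_finite_moment:
  fixes p :: "'a pmf"
  assumes "finite_moment p"
  shows "(\<integral>\<^sup>+x. ennreal (len x) \<partial>p) = ennreal (moment p)"
  using nn_integral_pmf_infsum[of len p] assms len_nonneg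
  by (simp add: finite_moment_def moment_def mult.commute)

lemma finite_momentI:
  fixes p :: "'a pmf"
  assumes "(\<integral>\<^sup>+x. ennreal (len x) \<partial>p) \<le> ennreal b" "0 \<le> b"
  shows "finite_moment p" "moment p \<le> b"
proof -
  obtain c where c: "0 \<le> c" "(\<integral>\<^sup>+x. ennreal (len x) \<partial>p) = ennreal c"
    "((\<lambda>x. pmf p x * len x) has_sum c) UNIV"
    by (rule has_sum_pmf_bounded[OF _ assms(1)]) (auto simp: len_nonneg)
  then show "finite_moment p"
    unfolding finite_moment_def using has_sum_imp_summable by (fastforce simp: mult.commute)
  have "moment p = c" unfolding moment_def using infsumI[OF c(3)] by (simp add: mult.commute)
  then show "moment p \<le> b" using c assms by simp
qed

lemma moment_convolution_pmf_le:
  fixes p q :: "'a pmf"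
  assumes "finite_moment p" "finite_moment q"
  shows "finite_moment (convolution_pmf p q)" "moment (convolution_pmf p q) \<le> moment p + moment q"
proof -
  have "(\<integral>\<^sup>+x. ennreal (len x) \<partial>convolution_pmf p q) = (\<integral>\<^sup>+x. \<integral>\<^sup>+y. ennreal (len (x + y)) \<partial>q \<partial>p)"
    by (rule nn_integral_convolution_pmf)
  also have "\<dots> \<le> (\<integral>\<^sup>+x. \<integral>\<^sup>+y. ennreal (len x) + ennreal (len y) \<partial>q \<partial>p)"
    by (intro nn_integral_mono)
      (auto simp: ennreal_plus[symmetric] len_nonneg len_add simp del: ennreal_plus intro!: ennreal_leI)
  also have "\<dots> = ennreal (moment p + moment q)"
    using assms
    by (simp add: nn_integral_add measure_pmf.emeasure_space_1 nn_integral_finite_moment moment_nonneg)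
  finally have le: "(\<integral>\<^sup>+x. ennreal (len x) \<partial>convolution_pmf p q) \<le> ennreal (moment p + moment q)" .
  show "finite_moment (convolution_pmf p q)" "moment (convolution_pmf p q) \<le> moment p + moment q"
    using finite_momentI[OF le] by (simp_all add: moment_nonneg)
qed

lemma moment_conv_power_le:
  assumes "finite_moment \<mu>"
  shows "finite_moment (conv_power \<mu> n)" "moment (conv_power \<mu> n) \<le> real n * moment \<mu>"
proof (induction n)
  case 0
  have "(\<integral>\<^sup>+x. ennreal (len x) \<partial>conv_power \<mu> 0) \<le> ennreal 0" by (simp add: len_0)
  from finite_momentI[OF this] show "finite_moment (conv_power \<mu> 0)"
    "moment (conv_power \<mu> 0) \<le> real 0 * moment \<mu>" by simp_all
next
  case (Suc n)
  then show "finite_moment (conv_power \<mu> (Suc n))"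
    "moment (conv_power \<mu> (Suc n)) \<le> real (Suc n) * moment \<mu>"
    using moment_convolution_pmf_le[OF Suc(1) assms] by (simp_all add: algebra_simps)
qed

lemma moment_conv_power_ge:
  assumes "finite_moment \<mu>"
  shows "real n * lim (\<lambda>n. moment (conv_power \<mu> n) / real n) \<le> moment (conv_power \<mu> n)"
    "0 \<le> lim (\<lambda>n. moment (conv_power \<mu> n) / real n)"
proof -
  have "moment (conv_power \<mu> (m + n)) \<le> moment (conv_power \<mu> m) + moment (conv_power \<mu> n)" for m n
    unfolding conv_power_add by (intro moment_convolution_pmf_le moment_conv_power_le assms)
  then obtain l where "(\<lambda>n. moment (conv_power \<mu> n) / real n) \<longlonglongrightarrow> l"
    "\<And>n. real n * l \<le> moment (conv_power \<mu> n)" "0 \<le> l"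
    using subadditive_quotient_limit[of "\<lambda>n. moment (conv_power \<mu> n)"] moment_nonneg by metis
  then show "real n * lim (\<lambda>n. moment (conv_power \<mu> n) / real n) \<le> moment (conv_power \<mu> n)"
    "0 \<le> lim (\<lambda>n. moment (conv_power \<mu> n) / real n)"
    by (simp_all add: limI)
qed

text \<open>
  By subadditivity each convolution power has mean length at least \<open>n\<close> times the drift, so averaging
  over the geometric time loses nothing: \<open>(1 - z) / z\<close> times the mean length is at least the drift.
\<close>
lemma moment_stopped_walk_ge:
  fixes \<mu> :: "'a pmf"
  assumes \<mu>: "finite_moment \<mu>" and z: "0 < z" "z < 1"
  obtains L where "((\<lambda>x. pmf (stopped_walk z \<mu>) x * len x) has_sum L) UNIV"
    "lim (\<lambda>n. moment (conv_power \<mu> n) / real n) * (z / (1 - z)) \<le> L"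
proof -
  let ?p = "stopped_walk z \<mu>" and ?G = "geometric_pmf (1 - z)"
  let ?l = "lim (\<lambda>n. moment (conv_power \<mu> n) / real n)"
  have eq: "(\<integral>\<^sup>+x. ennreal (len x) \<partial>?p) = (\<integral>\<^sup>+n. ennreal (moment (conv_power \<mu> n)) \<partial>?G)"
    unfolding nn_integral_stopped_walk
    by (simp add: nn_integral_finite_moment moment_conv_power_le[OF \<mu>])
  also have "\<dots> \<le> (\<integral>\<^sup>+n. ennreal (0 + moment \<mu> * real n) \<partial>?G)"
    using moment_conv_power_le(2)[OF \<mu>] by (intro nn_integral_mono ennreal_leI) (simp add: mult.commute)
  also have "\<dots> = ennreal (0 + moment \<mu> * (z / (1 - z)))"
    by (rule nn_integral_geometric_affine[OF z]) (simp_all add: moment_nonneg)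
  finally have "(\<integral>\<^sup>+x. ennreal (len x) \<partial>?p) \<le> ennreal (0 + moment \<mu> * (z / (1 - z)))" .
  then obtain L where L: "0 \<le> L" "(\<integral>\<^sup>+x. ennreal (len x) \<partial>?p) = ennreal L"
    "((\<lambda>x. pmf ?p x * len x) has_sum L) UNIV"
    by (rule has_sum_pmf_bounded[OF len_nonneg])
  have "ennreal (0 + ?l * (z / (1 - z))) = (\<integral>\<^sup>+n. ennreal (0 + ?l * real n) \<partial>?G)"
    by (rule nn_integral_geometric_affine[OF z, symmetric]) (simp_all add: moment_conv_power_ge[OF \<mu>])
  also have "\<dots> \<le> (\<integral>\<^sup>+n. ennreal (moment (conv_power \<mu> n)) \<partial>?G)"
    using moment_conv_power_ge(1)[OF \<mu>] by (intro nn_integral_mono ennreal_leI) (simp add: mult.commute)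
  also have "\<dots> = ennreal L" using eq L(2) by simp
  finally have "?l * (z / (1 - z)) \<le> L" using L(1) by simp
  with L(3) show ?thesis by (rule that)
qed

lemma finite_moment_if_finite_second_moment:
  assumes "(\<lambda>x. (len x)\<^sup>2 * pmf \<mu> x) summable_on UNIV"
  shows "finite_moment \<mu>"
  unfolding finite_moment_def
proof (rule summable_on_comparison_test)
  show "(\<lambda>x. pmf \<mu> x + (len x)\<^sup>2 * pmf \<mu> x) summable_on UNIV"
    using assms has_sum_imp_summable[OF has_sum_pmf] by (intro summable_on_add)
  have "t \<le> 1 + t\<^sup>2" for t :: real
  proof -
    have "2 * t \<le> t\<^sup>2 + 1" using sum_squares_bound[of t 1] by simp
    then show ?thesis using zero_le_power2[of t] by linarith
  qed
  from mult_right_mono[OF this pmf_nonneg]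
  show "len x * pmf \<mu> x \<le> pmf \<mu> x + (len x)\<^sup>2 * pmf \<mu> x" for x
    by (simp add: algebra_simps)
qed (simp add: len_nonneg)

text \<open>
  The second tangent line summed over all pairs, with weight the length \<open>len (- x + y) / M\<close> signed like
  \<open>p x - p y\<close>.  The squared weights average to \<open>1\<close> by the choice of \<open>M\<close>.  Since the length is
  \<open>1\<close>-Lipschitz, the linear term dominates the Dirichlet form of \<open>p\<close> and the length with its sign
  reversed, that is, the growth of the mean length.  The hypothesis \<open>tanh s \<le> l / M\<close>, for the drift
  \<open>l\<close>, then lets the linear term absorb the quadratic ones.
\<close>
lemma stopped_walk_entropy_ge_drift:
  fixes \<mu> :: "'a pmf"
  assumes sym: "symmetric_pmf \<mu>" and fin: "finite_entropy_pmf \<mu>" and z: "0 < z" "z < 1" and s: "0 < s"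
    and M: "((\<lambda>g. (len g)\<^sup>2 * pmf \<mu> g) has_sum M\<^sup>2) UNIV" "0 < M"
    and drift: "tanh s \<le> lim (\<lambda>n. moment (conv_power \<mu> n) / real n) / M"
  shows "2 * s * tanh s \<le> (1 - z) / z * entropy_pmf (stopped_walk z \<mu>)"
proof -
  define p where "p = pmf (stopped_walk z \<mu>)"
  define k where "k = (cosh s)\<^sup>2 + s * cosh s / sinh s"
  define A where "A = 2 * (s * tanh s) - k * (tanh s)\<^sup>2"
  define B where "B = k * (tanh s)\<^sup>2 / M\<^sup>2"
  define E where "E = 2 * k * tanh s / M"
  define l where "l = lim (\<lambda>n. moment (conv_power \<mu> n) / real n)"
  have k: "0 \<le> k" using s by (auto simp: k_def intro!: add_nonneg_nonneg)
  have E: "0 \<le> E" using k s M(2) by (simp add: E_def)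
  have sym': "pmf \<mu> (- g) = pmf \<mu> g" for g using sym by (simp add: symmetric_pmf_def)
  obtain D where D: "D \<le> 2 * ((1 - z) / z * entropy_pmf (stopped_walk z \<mu>))"
    "((\<lambda>(x, y). pmf \<mu> (- x + y) * ((p x - p y) * (ln (p x) - ln (p y)))) has_sum D) (UNIV \<times> UNIV)"
    using has_sum_stopped_walk_entropy_production[OF sym fin z] unfolding p_def by blast
  obtain L where L: "((\<lambda>x. p x * len x) has_sum L) UNIV" "l * (z / (1 - z)) \<le> L"
    unfolding p_def l_def
    by (rule moment_stopped_walk_ge[OF finite_moment_if_finite_second_moment z])
      (rule has_sum_imp_summable[OF M(1)])
  define X where "X = 2 * ((1 - z) / z) * (len 0 - L)"
  have len_form: "((\<lambda>(x, y). pmf \<mu> (- x + y) * ((p x - p y) * (len x - len y)))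
      has_sum X) (UNIV \<times> UNIV)"
    using has_sum_stopped_walk_dirichlet_form[OF sym z L(1)[unfolded p_def]] by (simp add: p_def X_def)
  have p1: "(p has_sum 1) UNIV" unfolding p_def by (rule has_sum_pmf)
  have mass: "((\<lambda>(x, y). pmf \<mu> (- x + y) * p x) has_sum 1) (UNIV \<times> UNIV)"
    "((\<lambda>(x, y). pmf \<mu> (- x + y) * p y) has_sum 1) (UNIV \<times> UNIV)"
    using has_sum_kernel_left[OF has_sum_pmf _ p1, of \<mu>] has_sum_kernel_right[OF has_sum_pmf _ sym' p1]
    by simp_all
  let ?\<kappa> = "\<lambda>g. (len g)\<^sup>2 * pmf \<mu> g"
  have second: "((\<lambda>(x, y). ?\<kappa> (- x + y) * p x) has_sum M\<^sup>2) (UNIV \<times> UNIV)"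
    "((\<lambda>(x, y). ?\<kappa> (- x + y) * p y) has_sum M\<^sup>2) (UNIV \<times> UNIV)"
    using has_sum_kernel_left[OF M(1) _ p1] has_sum_kernel_right[OF M(1) _ _ p1]
    by (simp_all add: sym' len_minus)
  have "((\<lambda>u. A * (case u of (x, y) \<Rightarrow> pmf \<mu> (- x + y) * p x)
        + A * (case u of (x, y) \<Rightarrow> pmf \<mu> (- x + y) * p y)
        - B * (case u of (x, y) \<Rightarrow> ?\<kappa> (- x + y) * p x)
        - B * (case u of (x, y) \<Rightarrow> ?\<kappa> (- x + y) * p y)
        - E * (case u of (x, y) \<Rightarrow> pmf \<mu> (- x + y) * ((p x - p y) * (len x - len y))))
      has_sum A * 1 + A * 1 - B * M\<^sup>2 - B * M\<^sup>2 - E * X) (UNIV \<times> UNIV)"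
    using mass second len_form by (intro has_sum_diff_real has_sum_add has_sum_cmult_right)
  then have "A * 1 + A * 1 - B * M\<^sup>2 - B * M\<^sup>2 - E * X \<le> D"
  proof (rule has_sum_mono[OF _ D(2)])
    fix u :: "'a \<times> 'a"
    obtain x y where u: "u = (x, y)" by (cases u)
    let ?g = "- x + y"
    have "A * (p x + p y) - B * (len ?g)\<^sup>2 * (p x + p y) - E * ((p x - p y) * (len x - len y))
        \<le> (p x - p y) * (ln (p x) - ln (p y))" if pos: "0 < pmf \<mu> ?g"
    proof (cases "0 < p x")
      case True
      then have "0 < p y" using pmf_stopped_walk_pos_iff[OF sym z pos] by (simp add: p_def)
      define w where "w = (if p x \<ge> p y then 1 else - 1) * (len ?g / M)"
      have w2: "k * (tanh s)\<^sup>2 * w\<^sup>2 = B * (len ?g)\<^sup>2"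
        by (simp add: w_def B_def power_mult_distrib power_divide)
      have "- ((p x - p y) * (len x - len y)) \<le> \<bar>p x - p y\<bar> * len ?g"
        using abs_len_diff_le[of x y] mult_left_mono[of "\<bar>len x - len y\<bar>" "len ?g" "\<bar>p x - p y\<bar>"]
        by (simp add: abs_mult[symmetric])
      also have "\<dots> = M * (w * (p x - p y))" using M(2) by (simp add: w_def)
      finally have "E * - ((p x - p y) * (len x - len y)) \<le> E * (M * (w * (p x - p y)))"
        using E by (rule mult_left_mono)
      also have "\<dots> = 2 * k * tanh s * (w * (p x - p y))" using M(2) by (simp add: E_def)
      finally have "- (E * ((p x - p y) * (len x - len y))) \<le> 2 * k * tanh s * (w * (p x - p y))" by simp
      moreover have "(2 * (s * tanh s) - k * (tanh s)\<^sup>2 * (1 + w\<^sup>2)) * (p x + p y)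
          = A * (p x + p y) - B * (len ?g)\<^sup>2 * (p x + p y)"
        unfolding w2[symmetric] A_def by (simp add: algebra_simps)
      ultimately show ?thesis
        using log_difference_ge_weighted_difference[OF True \<open>0 < p y\<close> s, of w]
        unfolding k_def[symmetric] by linarith
    next
      case False
      then have "\<not> 0 < p y" using pmf_stopped_walk_pos_iff[OF sym z pos] by (simp add: p_def)
      with False have "p x = 0" "p y = 0" by (auto simp: p_def not_less intro: order.antisym)
      then show ?thesis by simp
    qed
    then have "pmf \<mu> ?g * (A * (p x + p y) - B * (len ?g)\<^sup>2 * (p x + p y) - E * ((p x - p y) * (len x - len y)))
        \<le> pmf \<mu> ?g * ((p x - p y) * (ln (p x) - ln (p y)))"
      by (cases "pmf \<mu> ?g = 0") (auto intro!: mult_left_mono simp: pmf_pos)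
    then show "A * (case u of (x, y) \<Rightarrow> pmf \<mu> (- x + y) * p x)
        + A * (case u of (x, y) \<Rightarrow> pmf \<mu> (- x + y) * p y)
        - B * (case u of (x, y) \<Rightarrow> ?\<kappa> (- x + y) * p x)
        - B * (case u of (x, y) \<Rightarrow> ?\<kappa> (- x + y) * p y)
        - E * (case u of (x, y) \<Rightarrow> pmf \<mu> (- x + y) * ((p x - p y) * (len x - len y)))
      \<le> (case u of (x, y) \<Rightarrow> pmf \<mu> (- x + y) * ((p x - p y) * (ln (p x) - ln (p y))))"
      by (simp add: u algebra_simps)
  qed
  moreover have "E * (2 * l) \<le> - (E * X)"
  proof -
    have "(1 - z) / z * (l * (z / (1 - z))) \<le> (1 - z) / z * L"
      using L(2) z by (intro mult_left_mono) auto
    moreover have "(1 - z) / z * (l * (z / (1 - z))) = l" using z by simp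
    ultimately have "E * (2 * l) \<le> E * (2 * ((1 - z) / z * L))"
      using E by (intro mult_left_mono) auto
    moreover have "- (E * (2 * q * (0 - L))) = E * (2 * (q * L))" for q :: real by simp
    ultimately show ?thesis unfolding X_def len_0 by metis
  qed
  moreover have "B * M\<^sup>2 = k * (tanh s)\<^sup>2" using M(2) by (simp add: B_def)
  moreover have "2 * (k * (tanh s)\<^sup>2) \<le> E * l"
  proof -
    have "2 * k * tanh s * tanh s \<le> 2 * k * tanh s * (l / M)"
      using drift k s unfolding l_def by (intro mult_left_mono) auto
    then show ?thesis by (simp add: E_def power2_eq_square)
  qed
  moreover have "A = 2 * (s * tanh s) - k * (tanh s)\<^sup>2" by (simp add: A_def)
  ultimately have "2 * (2 * (s * tanh s)) \<le> D" by linarith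
  then show ?thesis using D(1) by simp
qed

end

section \<open>Bounds for the asymptotic entropy\<close>

lemma tanh_artanh_real:
  fixes x :: real
  assumes "\<bar>x\<bar> < 1"
  shows "tanh (artanh x) = x"
proof -
  have "(1 + x) / (1 - x) > 0" using assms by auto
  then have "artanh x = ln (sqrt ((1 + x) / (1 - x)))" by (simp add: artanh_def ln_sqrt)
  moreover have "0 < sqrt ((1 + x) / (1 - x))" using \<open>(1 + x) / (1 - x) > 0\<close> by simp
  ultimately show ?thesis
    using assms \<open>(1 + x) / (1 - x) > 0\<close> by (simp add: tanh_ln_real field_simps)
qed

lemma artanh_real_pos:
  fixes x :: real
  assumes "0 < x" "x < 1"
  shows "0 < artanh x"
  using tanh_artanh_real[of x] assms tanh_real_pos_iff[of "artanh x"] by simp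

lemma group_length_dist:
  fixes d :: "'a::group_add \<Rightarrow> 'a \<Rightarrow> real"
  assumes "Metric_space UNIV d" "left_invariant_dist d"
  shows "group_length (\<lambda>g. d g 0)"
proof -
  interpret Metric_space UNIV d by fact
  have inv: "d (c + x) (c + y) = d x y" for c x y
    using assms(2) by (simp add: left_invariant_dist_def)
  show ?thesis
  proof
    fix x y :: 'a
    show "d (x + y) 0 \<le> d x 0 + d y 0"
      using triangle[of "x + y" x 0] inv[of x y 0] by simp
    show "d (- x) 0 = d x 0"
      using inv[of x "- x" 0] commute[of 0 x] by simp
    show "d 0 0 = 0" by simp
  qed
qed

text \<open>
  At \<open>tanh s = \<surd>(1 - \<rho>\<^sup>2)\<close> one has \<open>\<rho> cosh s = 1\<close>, and the tangent line evaluated at \<open>1 / cosh s = \<rho>\<close>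
  returns the value \<open>2 s tanh s\<close> of the function itself.
\<close>
lemma asymptotic_entropy_ge_spectral:
  fixes \<mu> :: "'a::group_add pmf"
  assumes "symmetric_pmf \<mu>" "finite_entropy_pmf \<mu>"
  defines "r \<equiv> sqrt (1 - (spectral_radius_pmf \<mu>)\<^sup>2)"
  shows "2 * r * artanh r \<le> asymptotic_entropy \<mu>" "r < 1"
proof -
  define \<rho> where "\<rho> = spectral_radius_pmf \<mu>"
  have \<rho>: "0 < \<rho>" "\<rho> \<le> 1"
    using spectral_radius_pos[OF assms(1)] limsup_return_probability(3) by (auto simp: \<rho>_def)
  have "1 - \<rho>\<^sup>2 < 1" "0 \<le> 1 - \<rho>\<^sup>2" using \<rho> by (auto simp: power_le_one)
  then have r: "0 \<le> r" "r < 1" "r\<^sup>2 = 1 - \<rho>\<^sup>2" by (auto simp: r_def \<rho>_def[symmetric])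
  show "r < 1" by fact
  show "2 * r * artanh r \<le> asymptotic_entropy \<mu>"
  proof (cases "r = 0")
    case True
    then show ?thesis using asymptotic_entropy_limit(2)[OF assms(2)] by simp
  next
    case False
    define s where "s = artanh r"
    have s: "0 < s" "tanh s = r" using False r tanh_artanh_real[of r] artanh_real_pos[of r]
      by (auto simp: s_def)
    have "sinh s = r * cosh s" using s(2) by (auto simp: tanh_def)
    then have "(cosh s)\<^sup>2 = r\<^sup>2 * (cosh s)\<^sup>2 + 1"
      using cosh_square_eq[of s] by (simp add: power_mult_distrib)
    then have "(\<rho> * cosh s)\<^sup>2 = 1" unfolding r(3) by (simp add: power_mult_distrib algebra_simps)
    then have c: "\<rho> * cosh s = 1" using \<rho> cosh_real_pos[of s] by (smt (verit) power2_eq_1_iff mult_pos_pos)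
    have "2 + 2 * (s * cosh s / sinh s) - 2 * (cosh s + s / sinh s) * \<rho> = 2 * r * s"
    proof -
      have "(cosh s + s / sinh s) * \<rho> = 1 + s * \<rho> / sinh s" using c by (simp add: algebra_simps)
      moreover have "s * cosh s / sinh s - s * \<rho> / sinh s = s * r"
      proof -
        have "cosh s - \<rho> = cosh s * (1 - \<rho>\<^sup>2)" using c by (simp add: power2_eq_square algebra_simps)
        also have "\<dots> = r * sinh s" unfolding r(3)[symmetric] \<open>sinh s = r * cosh s\<close>
          by (simp add: power2_eq_square)
        finally show ?thesis using s(1) by (simp add: diff_divide_distrib[symmetric] right_diff_distrib[symmetric])
      qed
      ultimately show ?thesis by (simp add: algebra_simps)
    qed
    then have "2 * r * s \<le> asymptotic_entropy \<mu>"
      using stopped_walk_entropy_ge_spectral[OF assms(1,2) _ _ s(1)]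
      by (intro asymptotic_entropy_geI[OF assms(2)]) (simp add: \<rho>_def)
    then show ?thesis by (simp add: s_def)
  qed
qed

text \<open>
  The bound \<open>2 s tanh s \<le> h\<close> holds for every \<open>s\<close> with \<open>tanh s \<le> r\<close>.  If \<open>r\<close> were at least \<open>1\<close>, this
  would allow arbitrarily large \<open>s\<close>, contradicting \<open>h < \<infinity>\<close>; otherwise take \<open>s = artanh r\<close>.
\<close>
lemma asymptotic_entropy_ge_drift:
  fixes d :: "'a::group_add \<Rightarrow> 'a \<Rightarrow> real"
  assumes d: "Metric_space UNIV d" "left_invariant_dist d"
    and \<mu>: "symmetric_pmf \<mu>" "finite_entropy_pmf \<mu>" "finite_second_moment d \<mu>" "\<mu> \<noteq> return_pmf 0"
  defines "r \<equiv> drift d \<mu> / M2 d \<mu>"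
  shows "2 * r * artanh r \<le> asymptotic_entropy \<mu>" "r < 1"
proof -
  interpret Metric_space UNIV d by fact
  interpret group_length "\<lambda>g. d g 0" by (rule group_length_dist[OF d])
  have summable: "(\<lambda>g. (d g 0)\<^sup>2 * pmf \<mu> g) summable_on UNIV"
    using \<mu>(3) by (simp add: finite_second_moment_def)
  have nonneg: "0 \<le> (\<Sum>\<^sub>\<infinity>g. (d g 0)\<^sup>2 * pmf \<mu> g)" by (intro infsum_nonneg) auto
  have M: "((\<lambda>g. (d g 0)\<^sup>2 * pmf \<mu> g) has_sum (M2 d \<mu>)\<^sup>2) UNIV"
    using has_sum_infsum[OF summable] nonneg by (simp add: M2_def)
  obtain g where g: "g \<in> set_pmf \<mu>" "g \<noteq> 0"
    using \<mu>(4) set_pmf_subset_singleton[of \<mu> 0] by blast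
  have "0 < (d g 0)\<^sup>2 * pmf \<mu> g" using g by (simp add: pmf_positive)
  also have "\<dots> \<le> (M2 d \<mu>)\<^sup>2" using finite_sum_le_has_sum[OF M, of "{g}"] by simp
  finally have Mpos: "0 < M2 d \<mu>" using nonneg by (simp add: M2_def less_le)
  have r: "r = lim (\<lambda>n. moment (conv_power \<mu> n) / real n) / M2 d \<mu>"
    by (simp add: r_def drift_def moment_def)
  have "0 \<le> r" unfolding r using Mpos
    moment_conv_power_ge(2)[OF finite_moment_if_finite_second_moment[OF summable]] by simp
  have bound: "2 * s * tanh s \<le> asymptotic_entropy \<mu>" if "0 < s" "tanh s \<le> r" for s
    using stopped_walk_entropy_ge_drift[OF \<mu>(1,2) _ _ that(1) M Mpos that(2)[unfolded r]]
    by (intro asymptotic_entropy_geI[OF \<mu>(2)])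
  show "r < 1"
  proof (rule ccontr)
    assume "\<not> r < 1"
    \<comment> \<open>As \<open>s \<ge> 1\<close>, already \<open>2 s tanh 1 = 2 tanh 1 + h\<close> exceeds \<open>h\<close>.\<close>
    define s where "s = 1 + asymptotic_entropy \<mu> / (2 * tanh 1)"
    have s: "1 \<le> s" using asymptotic_entropy_limit(2)[OF \<mu>(2)] by (simp add: s_def)
    then have "2 * s * tanh 1 \<le> 2 * s * tanh s" by (intro mult_left_mono) auto
    also have "\<dots> \<le> asymptotic_entropy \<mu>"
      using s \<open>\<not> r < 1\<close> tanh_real_lt_1[of s] by (intro bound) auto
    finally have "2 * s * tanh 1 \<le> asymptotic_entropy \<mu>" .
    moreover have "0 < tanh (1 :: real)" by simp
    moreover from this have "2 * s * tanh 1 = 2 * tanh 1 + asymptotic_entropy \<mu>"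
      by (simp add: s_def distrib_right)
    ultimately show False by linarith
  qed
  show "2 * r * artanh r \<le> asymptotic_entropy \<mu>"
  proof (cases "r = 0")
    case True
    then show ?thesis using asymptotic_entropy_limit(2)[OF \<mu>(2)] by simp
  next
    case False
    with \<open>0 \<le> r\<close> \<open>r < 1\<close> bound[of "artanh r"] show ?thesis
      using tanh_artanh_real[of r] artanh_real_pos[of r] by (simp add: mult_ac)
  qed
qed

theorem theorem1p2:
  fixes d :: "'a::{group_add, countable} \<Rightarrow> 'a \<Rightarrow> real"
    and \<mu> :: "'a pmf"
  assumes "Metric_space UNIV d"
    and "proper_dist d"
    and "left_invariant_dist d"
    and "symmetric_pmf \<mu>"
    and "finite_entropy_pmf \<mu>"
  shows "(let s = sqrt (1 - (spectral_radius_pmf \<mu>)\<^sup>2)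
          in 2 * ereal s * artanh_ext s \<le> ereal (asymptotic_entropy \<mu>)) \<and>
         (finite_second_moment d \<mu> \<and> \<mu> \<noteq> return_pmf 0 \<longrightarrow>
          (let l = drift d \<mu> / M2 d \<mu>
           in 2 * ereal l * artanh_ext l \<le> ereal (asymptotic_entropy \<mu>)))"
proof -
  have artanh: "2 * ereal r * artanh_ext r \<le> ereal c" if "r < 1" "2 * r * artanh r \<le> c" for r c :: real
  proof -
    have "2 * ereal r * artanh_ext r = ereal (2 * r * artanh r)"
      by (simp only: artanh_ext_def that(1) if_True numeral_eq_ereal times_ereal.simps)
    with that(2) show ?thesis by simp
  qed
  show ?thesis unfolding Let_def
  proof (intro conjI impI)
    show "2 * ereal (sqrt (1 - (spectral_radius_pmf \<mu>)\<^sup>2)) * artanh_ext (sqrt (1 - (spectral_radius_pmf \<mu>)\<^sup>2))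
        \<le> ereal (asymptotic_entropy \<mu>)"
      using asymptotic_entropy_ge_spectral[OF assms(4,5)] by (intro artanh)
    assume "finite_second_moment d \<mu> \<and> \<mu> \<noteq> return_pmf 0"
    then show "2 * ereal (drift d \<mu> / M2 d \<mu>) * artanh_ext (drift d \<mu> / M2 d \<mu>)
        \<le> ereal (asymptotic_entropy \<mu>)"
      using asymptotic_entropy_ge_drift[OF assms(1,3,4,5)] by (intro artanh) auto
  qed
qed

end
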